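(* For $\tau\in\mathbb{H}^2$ let $q=e^{2\pi i\tau}$ and $$W=\theta^2\begin{bmatrix}1\\ \frac14\end{bmatrix}(0,\tau)\Big/\theta^2\begin{bmatrix}1\\ \frac34\end{bmatrix}(0,\tau).$$ Then $W$ satisfies the Riccati equation $$q\frac{dW}{dq}=\frac1{(\sqrt2)^5}\,\frac{(q;q)_\infty^2(q^2;q^2)_\infty(q^4;q^4)_\infty^3}{(q^8;q^8)_\infty^2}\left(W^2-6W+1\right).$$
   Context: $\mathbb{H}^2$ is the upper half-plane. For $\epsilon,\epsilon'\in\mathbb{R}$, $\theta\begin{bmatrix}\epsilon\\ \epsilon'\end{bmatrix}(\zeta,\tau)=\sum_{n\in\mathbb{Z}}\exp\!\Big(2\pi i\Big[\tfrac12\big(n+\tfrac{\epsilon}{2}\big)^2\tau+\big(n+\tfrac{\epsilon}{2}\big)\big(\zeta+\tfrac{\epsilon'}{2}\big)\Big]\Big)$; $\theta^k$ is the $k$-th power. $(q^k;q^k)_\infty=\prod_{n\ge1}(1-q^{kn})$. The derivative $q\,d/dq$ is understood as $\frac{1}{2\pi i}\frac{d}{d\tau}$. *)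

theory Defs
  imports "HOL-Analysis.Analysis"
begin

definition theta_char :: "real \<Rightarrow> real \<Rightarrow> complex \<Rightarrow> complex \<Rightarrow> complex" where
  "theta_char e e' z t =
     (\<Sum>\<^sub>\<infinity>n::int. exp (2 * pi * \<i> *
        ((1/2) * (of_int n + of_real e / 2)^2 * t + (of_int n + of_real e / 2) * (z + of_real e' / 2))))"

definition qpoch_inf :: "complex \<Rightarrow> complex" where
  "qpoch_inf a = (\<Prod>n. (1 - a ^ (Suc n)))"

definition upper_half_plane :: "complex set" where
  "upper_half_plane = {t. Im t > 0}"

end

theory Submission
  imports Defs "HOL-Complex_Analysis.Cauchy_Integral_Formula"
begin

text \<open>
  Let \<open>A\<close> and \<open>B\<close> be the two theta constants, so that \<open>W = A\<^sup>2 / B\<^sup>2\<close> and the claim concerns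
  \<open>2 A B (A' B - A B')\<close> and the quartic form \<open>A\<^sup>4 - 6 A\<^sup>2 B\<^sup>2 + B\<^sup>4 = (A\<^sup>2 - B\<^sup>2)\<^sup>2 - 4 (A B)\<^sup>2\<close>.
  Rotating the lattice of double sums by \<open>(k, l) = (s + t, s - t)\<close> factors each of \<open>A B\<close>, \<open>A\<^sup>2 - B\<^sup>2\<close> and
  \<open>A' B - A B'\<close> into single theta series: the first two become \<open>P \<theta>\<^sub>4\<close> and \<open>2 P \<theta>\<^sub>3\<close> at \<open>2\<tau>\<close> with a common
  factor \<open>P\<close>, and \<open>\<theta>\<^sub>3\<^sup>2 - \<theta>\<^sub>4\<^sup>2\<close> at \<open>2\<tau>\<close> is twice the square of \<open>\<theta>\<^sub>2\<close> at \<open>4\<tau>\<close>. In the Wronskian the weight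
  \<open>k\<^sup>2 - l\<^sup>2 = 4 s t\<close> produces the series \<open>\<Sum> (2n + 1) (-1)\<^sup>n x\<^bsup>n(n+1)/2\<^esup>\<close> in both factors.
  All remaining series are infinite products by the Jacobi triple product and its limiting case, the
  identity for the cube of the Euler product, and the claim becomes an identity of monomials in these products.
\<close>

section \<open>The Jacobi triple product\<close>

text \<open>Tannery's theorem. The M-test makes the finite partial sums converge uniformly in
  \<open>n\<close>, and a uniform limit may be interchanged with the limit in
  \<open>n\<close>.\<close>

lemma tendsto_infsum_dominated:
  fixes f :: "'a \<Rightarrow> nat \<Rightarrow> 'b :: banach"
  assumes lim: "\<And>x. x \<in> X \<Longrightarrow> f x \<longlonglongrightarrow> g x"
    and bound: "\<And>x n. x \<in> X \<Longrightarrow> norm (f x n) \<le> M x"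
    and M: "M summable_on X"
  shows "(\<lambda>n. \<Sum>\<^sub>\<infinity>x\<in>X. f x n) \<longlonglongrightarrow> (\<Sum>\<^sub>\<infinity>x\<in>X. g x)"
proof (rule swap_uniform_limit')
  have le: "norm (g x) \<le> M x" if "x \<in> X" for x
    by (rule tendsto_upperbound[OF tendsto_norm[OF lim[OF that]]]) (use bound that in auto)
  have "(\<lambda>x. norm (g x)) summable_on X"
    by (rule summable_on_comparison_test[OF M]) (use le in auto)
  then have "g summable_on X"
    by (rule abs_summable_summable)
  then show "(sum g \<longlongrightarrow> (\<Sum>\<^sub>\<infinity>x\<in>X. g x)) (finite_subsets_at_top X)"
    by (rule infsum_tendsto)
  show "\<forall>\<^sub>F Y in finite_subsets_at_top X. (\<lambda>n. \<Sum>x\<in>Y. f x n) \<longlonglongrightarrow> sum g Y"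
    unfolding eventually_finite_subsets_at_top
    by (rule exI[of _ "{}"]) (auto intro!: tendsto_sum lim)
  show "uniform_limit UNIV (\<lambda>Y n. \<Sum>x\<in>Y. f x n) (\<lambda>n. \<Sum>\<^sub>\<infinity>x\<in>X. f x n) (finite_subsets_at_top X)"
    by (rule Weierstrass_m_test_general[OF _ M]) (use bound in auto)
qed auto

section \<open>Terms of the bilateral series in the triple product, and their summability\<close>

definition jacobi_term :: "complex \<Rightarrow> complex \<Rightarrow> int \<Rightarrow> complex" where
  "jacobi_term Q z n = z powi n * Q powi (n * (n - 1) div 2)"

lemma jacobi_term_reflect:
  assumes "z \<noteq> 0"
  shows "jacobi_term Q z (1 - n) = z * jacobi_term Q (1 / z) n"
proof -
  have "z powi (1 - n) = z * (1 / z) powi n"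
    using assms by (simp add: power_int_diff power_int_divide_distrib)
  moreover have "(1 - n) * ((1 - n) - 1) = n * (n - 1)"
    by (simp add: algebra_simps)
  ultimately show ?thesis
    unfolding jacobi_term_def by (simp only: mult.assoc)
qed

lemma triangular_add_1: "(n + 1) * (n + 1 - 1) div 2 = n * (n - 1) div 2 + (n :: int)"
proof -
  have "(n + 1) * (n + 1 - 1) = n * (n - 1) + n * 2"
    by (simp add: algebra_simps)
  then show ?thesis
    by simp
qed

lemma jacobi_term_shift:
  assumes "z \<noteq> 0" "Q \<noteq> 0"
  shows "jacobi_term Q z (n + 1) = z * jacobi_term Q (z * Q) n"
  unfolding jacobi_term_def triangular_add_1 using assms by (simp add: power_int_add power_int_mult_distrib)

lemma jacobi_term_Suc:
  assumes "z \<noteq> 0" "Q \<noteq> 0"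
  shows "jacobi_term Q z (int (Suc m)) = z * Q ^ m * jacobi_term Q z (int m)"
  using jacobi_term_shift[OF assms, of "int m"]
  by (simp add: jacobi_term_def power_int_mult_distrib power_mult_distrib mult_ac add.commute)

text \<open>Ratio test: the quotient \<open>z * Q ^ m\<close> of consecutive terms tends to 0, and
  the weight at most doubles in one step, so 1/4 for the quotient gives ratio 1/2. The weight
  \<open>m + 2\<close> is large enough to dominate \<open>\<bar>1 - m\<bar> + 1\<close> on the
  reflected half of the integers.\<close>

lemma summable_jacobi_term_nat:
  assumes "norm Q < 1" "Q \<noteq> 0" "z \<noteq> 0"
  shows "summable (\<lambda>m. (real m + 2) * norm (jacobi_term Q z (int m)))"
proof -
  have "(\<lambda>m. norm z * norm Q ^ m) \<longlonglongrightarrow> norm z * 0"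
    by (intro tendsto_intros LIMSEQ_power_zero) (use assms in auto)
  then have "\<forall>\<^sub>F m in sequentially. norm z * norm Q ^ m < 1/4"
    by (rule order_tendstoD) simp
  then obtain N where N: "norm z * norm Q ^ m < 1/4" if "m \<ge> N" for m
    by (auto simp: eventually_sequentially)
  show ?thesis
  proof (rule summable_ratio_test[where c = "1/2" and N = N])
    fix m assume "N \<le> m"
    have "(real (Suc m) + 2) * (norm z * norm Q ^ m) \<le> (2 * (real m + 2)) * (1/4)"
      using N[OF \<open>N \<le> m\<close>] by (intro mult_mono) auto
    then have "(real (Suc m) + 2) * (norm z * norm Q ^ m) * norm (jacobi_term Q z (int m))
        \<le> (2 * (real m + 2)) * (1/4) * norm (jacobi_term Q z (int m))"
      by (rule mult_right_mono) simp
    then show "norm ((real (Suc m) + 2) * norm (jacobi_term Q z (int (Suc m))))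
        \<le> 1/2 * norm ((real m + 2) * norm (jacobi_term Q z (int m)))"
      unfolding jacobi_term_Suc[OF assms(3,2)] by (simp add: norm_mult norm_power algebra_simps)
  qed simp
qed

text \<open>The reflection \<open>n \<mapsto> 1 - n\<close>, \<open>z \<mapsto> 1 / z\<close>
  carries the negative half to the natural numbers. Both halves contain 0 and 1, which is harmless
  for summability. One linear weight serves both the series and its derivative in
  \<open>z\<close>.\<close>

lemma jacobi_term_weighted_summable:
  assumes "norm Q < 1" "Q \<noteq> 0" "z \<noteq> 0"
  shows "(\<lambda>n. (real_of_int \<bar>n\<bar> + 1) * norm (jacobi_term Q z n)) summable_on UNIV"
proof -
  let ?f = "\<lambda>n. (real_of_int \<bar>n\<bar> + 1) * norm (jacobi_term Q z n)"
  have nat: "(\<lambda>m. (real m + 2) * norm (jacobi_term Q w (int m))) summable_on UNIV" if "w \<noteq> 0" for w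
    by (intro summable_nonneg_imp_summable_on summable_jacobi_term_nat that assms) auto
  have pos: "?f summable_on range int"
    by (subst summable_on_reindex, simp, rule summable_on_comparison_test[OF nat[OF assms(3)]])
      (auto intro!: mult_right_mono)
  have "?f summable_on range (\<lambda>m. 1 - int m)"
  proof (subst summable_on_reindex)
    have "(\<lambda>m. norm z * ((real m + 2) * norm (jacobi_term Q (1/z) (int m)))) summable_on UNIV"
      by (intro summable_on_cmult_right nat) (use assms in auto)
    then show "(?f \<circ> (\<lambda>m. 1 - int m)) summable_on UNIV"
    proof (rule summable_on_comparison_test)
      fix m :: nat
      have "real_of_int \<bar>1 - int m\<bar> + 1 \<le> real m + 2"
        by linarith
      then show "(?f \<circ> (\<lambda>m. 1 - int m)) m \<le> norm z * ((real m + 2) * norm (jacobi_term Q (1/z) (int m)))"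
        unfolding o_def jacobi_term_reflect[OF assms(3)] norm_mult
        by (simp add: mult.left_commute mult_left_mono mult_right_mono)
    qed auto
  qed (auto simp: inj_on_def)
  with pos have "?f summable_on range int \<union> range (\<lambda>m. 1 - int m)"
    by (rule summable_on_union)
  also have "range int \<union> range (\<lambda>m. 1 - int m) = UNIV"
  proof -
    have "n \<in> range int \<union> range (\<lambda>m. 1 - int m)" for n
    proof (cases "n \<ge> 0")
      case True
      then show ?thesis by (auto intro: range_eqI[of _ _ "nat n"])
    next
      case False
      then show ?thesis by (auto intro!: range_eqI[of _ _ "nat (1 - n)"])
    qed
    then show ?thesis by blast
  qed
  finally show ?thesis .
qed

lemma jacobi_term_abs_summable:
  assumes "norm Q < 1" "Q \<noteq> 0" "z \<noteq> 0"
  shows "(\<lambda>n. norm (jacobi_term Q z n)) summable_on UNIV"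
  by (rule summable_on_comparison_test[OF jacobi_term_weighted_summable[OF assms]])
    (auto simp: algebra_simps)

lemma jacobi_term_deriv_abs_summable:
  assumes "norm Q < 1" "Q \<noteq> 0" "z \<noteq> 0"
  shows "(\<lambda>n. norm (of_int n * jacobi_term Q z n)) summable_on UNIV"
  by (rule summable_on_comparison_test[OF jacobi_term_weighted_summable[OF assms]])
    (auto simp: algebra_simps norm_mult)

section \<open>Finite and infinite Euler products\<close>

definition qpoch_fin :: "complex \<Rightarrow> nat \<Rightarrow> complex" where
  "qpoch_fin Q N = (\<Prod>k<N. 1 - Q ^ Suc k)"

lemma power_neq_1_of_norm_less_1:
  fixes Q :: complex
  assumes "norm Q < 1"
  shows "Q ^ Suc k \<noteq> 1"
proof -
  have "norm (Q ^ Suc k) \<le> norm Q"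
    using assms by (simp add: norm_mult norm_power mult_left_le power_le_one)
  with assms show ?thesis by auto
qed

lemma qpoch_fin_nonzero: "norm Q < 1 \<Longrightarrow> qpoch_fin Q N \<noteq> 0"
  unfolding qpoch_fin_def using power_neq_1_of_norm_less_1[of Q] by simp

lemma qpoch_convergent_prod:
  fixes Q :: complex
  assumes "norm Q < 1"
  shows "convergent_prod (\<lambda>k. 1 - Q ^ Suc k)"
proof (intro abs_convergent_prod_imp_convergent_prod summable_imp_abs_convergent_prod)
  have "summable (\<lambda>k. norm Q * norm Q ^ k)"
    by (intro summable_mult summable_geometric) (use assms in auto)
  then show "summable (\<lambda>k. norm (1 - Q ^ Suc k - 1))"
    by (simp add: norm_mult norm_power)
qed

lemma qpoch_inf_nonzero: "norm Q < 1 \<Longrightarrow> qpoch_inf Q \<noteq> 0"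
  unfolding qpoch_inf_def
  by (rule prodinf_nonzero[OF qpoch_convergent_prod]) (use power_neq_1_of_norm_less_1 in force)+

lemma qpoch_fin_tendsto:
  assumes "norm Q < 1"
  shows "qpoch_fin Q \<longlonglongrightarrow> qpoch_inf Q"
  using convergent_prod_LIMSEQ[OF qpoch_convergent_prod[OF assms]]
  unfolding qpoch_fin_def qpoch_inf_def by (subst (asm) LIMSEQ_lessThan_iff_atMost[symmetric])

section \<open>Gaussian binomial coefficients and the q-binomial theorem\<close>

fun qbinom :: "complex \<Rightarrow> nat \<Rightarrow> nat \<Rightarrow> complex" where
  "qbinom Q n 0 = 1"
| "qbinom Q 0 (Suc k) = 0"
| "qbinom Q (Suc n) (Suc k) = qbinom Q n k + Q ^ Suc k * qbinom Q n (Suc k)"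

lemma qbinom_eq_0: "n < k \<Longrightarrow> qbinom Q n k = 0"
  by (induction Q n k rule: qbinom.induct) auto

lemma qpoch_fin_Suc: "qpoch_fin Q (Suc n) = qpoch_fin Q n * (1 - Q ^ Suc n)"
  by (simp add: qpoch_fin_def)

text \<open>The two terms of the q-Pascal rule recombine through
  \<open>(1 - Q ^ a) + Q ^ a * (1 - Q ^ b) = 1 - Q ^ (a + b)\<close>. For \<open>b = 0\<close> the
  second term vanishes, as does its claimed value.\<close>

lemma qbinom_mult_qpoch_fin: "qbinom Q (a + b) a * (qpoch_fin Q a * qpoch_fin Q b) = qpoch_fin Q (a + b)"
proof (induction "a + b" arbitrary: a b rule: less_induct)
  case less
  show ?case
  proof (cases a)
    case 0
    then show ?thesis by (simp add: qpoch_fin_def)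
  next
    case (Suc a')
    have 1: "qbinom Q (a' + b) a' * (qpoch_fin Q a' * qpoch_fin Q b) = qpoch_fin Q (a' + b)"
      using less[of a' b] Suc by simp
    have 2: "qbinom Q (a' + b) (Suc a') * (qpoch_fin Q (Suc a') * qpoch_fin Q b) = qpoch_fin Q (a' + b) * (1 - Q ^ b)"
    proof (cases b)
      case 0
      then show ?thesis by (simp add: qbinom_eq_0)
    next
      case (Suc b')
      have "qbinom Q (Suc a' + b') (Suc a') * (qpoch_fin Q (Suc a') * qpoch_fin Q b') = qpoch_fin Q (Suc a' + b')"
        using less[of "Suc a'" b'] \<open>a = Suc a'\<close> Suc by simp
      then show ?thesis using Suc by (simp add: qpoch_fin_Suc mult_ac)
    qed
    have "qbinom Q (a + b) a * (qpoch_fin Q a * qpoch_fin Q b)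
        = (qbinom Q (a' + b) a' * (qpoch_fin Q a' * qpoch_fin Q b)) * (1 - Q ^ Suc a')
          + Q ^ Suc a' * (qbinom Q (a' + b) (Suc a') * (qpoch_fin Q (Suc a') * qpoch_fin Q b))"
      unfolding Suc add_Suc qbinom.simps qpoch_fin_Suc[of Q a'] by (simp only: algebra_simps)
    also have "\<dots> = qpoch_fin Q (a' + b) * (1 - Q ^ Suc (a' + b))"
      unfolding 1 2 by (simp add: algebra_simps power_add)
    finally show ?thesis
      by (simp add: Suc qpoch_fin_Suc)
  qed
qed

lemma choose_two_Suc: "Suc k choose 2 = k + (k choose 2)"
  by (simp add: numeral_2_eq_2)

text \<open>Splitting off the factor \<open>i = 0\<close> leaves the shorter product at
  \<open>y * Q\<close>, which is why \<open>y\<close> is generalized in the induction. Comparing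
  coefficients of \<open>y ^ Suc k\<close> is then the q-Pascal rule.\<close>

lemma q_binomial_theorem:
  "(\<Prod>i<n. 1 + y * Q ^ i) = (\<Sum>k\<le>n. Q ^ (k choose 2) * qbinom Q n k * y ^ k)"
proof (induction n arbitrary: y)
  case 0
  then show ?case by (simp add: numeral_2_eq_2)
next
  case (Suc n)
  let ?a = "\<lambda>k. Q ^ (k choose 2) * qbinom Q n k * (y * Q) ^ k"
  have "(\<Prod>i<Suc n. 1 + y * Q ^ i) = (1 + y) * (\<Prod>i<n. 1 + (y * Q) * Q ^ i)"
    by (subst prod.lessThan_Suc_shift) (simp add: mult_ac)
  also have "\<dots> = (\<Sum>k\<le>n. ?a k) + y * (\<Sum>k\<le>n. ?a k)"
    unfolding Suc.IH by (simp add: algebra_simps)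
  also have "(\<Sum>k\<le>n. ?a k) + y * (\<Sum>k\<le>n. ?a k) = 1 + (\<Sum>k\<le>n. ?a (Suc k)) + y * (\<Sum>k\<le>n. ?a k)"
  proof -
    have "(\<Sum>k\<le>n. ?a k) = (\<Sum>k\<le>Suc n. ?a k)"
      by (simp add: qbinom_eq_0)
    also have "\<dots> = 1 + (\<Sum>k\<le>n. ?a (Suc k))"
      by (subst sum.atMost_Suc_shift) (simp add: numeral_2_eq_2)
    finally show ?thesis
      by simp
  qed
  also have "1 + (\<Sum>k\<le>n. ?a (Suc k)) + y * (\<Sum>k\<le>n. ?a k)
      = 1 + (\<Sum>k\<le>n. Q ^ (Suc k choose 2) * qbinom Q (Suc n) (Suc k) * y ^ Suc k)"
    unfolding sum_distrib_left add.assoc sum.distrib[symmetric]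
    by (intro arg_cong2[where f = "(+)"] sum.cong refl)
      (simp add: choose_two_Suc algebra_simps power_add power_mult_distrib)
  also have "\<dots> = (\<Sum>k\<le>Suc n. Q ^ (k choose 2) * qbinom Q (Suc n) k * y ^ k)"
    by (subst sum.atMost_Suc_shift) (simp add: numeral_2_eq_2)
  finally show ?case .
qed

lemma qbinom_eq:
  assumes "norm Q < 1"
  shows "qbinom Q (a + b) a = qpoch_fin Q (a + b) / (qpoch_fin Q a * qpoch_fin Q b)"
  using qbinom_mult_qpoch_fin[of Q a b] qpoch_fin_nonzero[OF assms] by (simp add: field_simps)

text \<open>The finite Euler products converge to a nonzero limit, so they and their inverses are
  bounded. The resulting bound is uniform in both indices, as needed for domination in the limit of
  the finite triple product.\<close>

lemma qbinom_bounded: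
  fixes Q :: complex
  assumes "norm Q < 1"
  obtains C where "\<And>a b. norm (qbinom Q (a + b) a) \<le> C"
proof -
  have "qpoch_fin Q \<longlonglongrightarrow> qpoch_inf Q" "(\<lambda>n. inverse (qpoch_fin Q n)) \<longlonglongrightarrow> inverse (qpoch_inf Q)"
    by (intro tendsto_inverse qpoch_fin_tendsto qpoch_inf_nonzero assms)+
  then have "Bseq (qpoch_fin Q)" "Bseq (\<lambda>n. inverse (qpoch_fin Q n))"
    by (blast intro: convergent_imp_Bseq convergentI)+
  then obtain K L where K: "K > 0" "\<And>n. norm (qpoch_fin Q n) \<le> K"
    and L: "\<And>n. norm (inverse (qpoch_fin Q n)) \<le> L"
    by (meson Bseq_def)
  have "L \<ge> 0"
    using L[of 0] norm_ge_zero order_trans by blast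
  show thesis
  proof (rule that)
    fix a b
    have "qbinom Q (a + b) a = qpoch_fin Q (a + b) * (inverse (qpoch_fin Q a) * inverse (qpoch_fin Q b))"
      unfolding qbinom_eq[OF assms] by (simp add: divide_inverse)
    also have "norm \<dots> \<le> K * (L * L)"
      unfolding norm_mult using K L \<open>L \<ge> 0\<close> by (intro mult_mono) auto
    finally show "norm (qbinom Q (a + b) a) \<le> K * (L * L)" .
  qed
qed

section \<open>Limit of sums with central Gaussian binomial coefficients\<close>

lemma filterlim_nat_shift: "filterlim (\<lambda>N. nat (c + int N)) at_top sequentially"
  unfolding filterlim_at_top
proof
  fix Z
  show "\<forall>\<^sub>F N in sequentially. Z \<le> nat (c + int N)"
    by (rule eventually_sequentiallyI[of "Z + nat \<bar>c\<bar>"]) linarith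
qed

text \<open>For fixed \<open>n\<close> the coefficient tends to
  \<open>qpoch_inf Q / (qpoch_inf Q * qpoch_inf Q)\<close>, that is, to
  \<open>1 / qpoch_inf Q\<close>. Uniform boundedness of the coefficients permits the limit under
  the sum.\<close>

lemma qbinom_sum_tendsto:
  assumes Q: "norm Q < 1" and w: "(\<lambda>n. norm (w n)) summable_on UNIV"
  shows "(\<lambda>N. \<Sum>n\<in>{-int N..int N + 1}. qbinom Q (2 * N + 1) (nat (n + int N)) * w n)
           \<longlonglongrightarrow> (\<Sum>\<^sub>\<infinity>n. w n) / qpoch_inf Q"
proof -
  obtain C where C: "\<And>a b. norm (qbinom Q (a + b) a) \<le> C"
    using qbinom_bounded[OF Q] by blast
  \<comment> \<open>Extension by 0 outside the window turns the growing finite sums into sums over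
    one fixed index set.\<close>
  define f where "f = (\<lambda>n N. if n \<in> {-int N..int N + 1}
      then qbinom Q (2 * N + 1) (nat (n + int N)) * w n else 0)"
  have split: "2 * N + 1 = nat (n + int N) + nat (1 - n + int N)" if "n \<in> {-int N..int N + 1}" for n N
    using that by auto
  have "(\<lambda>N. \<Sum>\<^sub>\<infinity>n. f n N) \<longlonglongrightarrow> (\<Sum>\<^sub>\<infinity>n. w n / qpoch_inf Q)"
  proof (rule tendsto_infsum_dominated[where M = "\<lambda>n. C * norm (w n)"])
    fix n :: int
    have "(\<lambda>N. qpoch_fin Q (2 * N + 1) / (qpoch_fin Q (nat (n + int N)) * qpoch_fin Q (nat (1 - n + int N))) * w n)
            \<longlonglongrightarrow> qpoch_inf Q / (qpoch_inf Q * qpoch_inf Q) * w n"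
    proof (intro tendsto_intros)
      show "(\<lambda>N. qpoch_fin Q (2 * N + 1)) \<longlonglongrightarrow> qpoch_inf Q"
        by (rule filterlim_compose[OF qpoch_fin_tendsto[OF Q]], rule filterlim_at_top_mono[OF filterlim_ident]) simp
    qed (auto intro!: filterlim_compose[OF qpoch_fin_tendsto[OF Q]] filterlim_nat_shift simp: qpoch_inf_nonzero Q)
    moreover have "\<forall>\<^sub>F N in sequentially.
        qpoch_fin Q (2 * N + 1) / (qpoch_fin Q (nat (n + int N)) * qpoch_fin Q (nat (1 - n + int N))) * w n = f n N"
    proof (rule eventually_sequentiallyI[of "nat \<bar>n\<bar>"])
      fix N assume "nat \<bar>n\<bar> \<le> N"
      then have n: "n \<in> {-int N..int N + 1}" by auto
      show "qpoch_fin Q (2 * N + 1) / (qpoch_fin Q (nat (n + int N)) * qpoch_fin Q (nat (1 - n + int N))) * w n = f n N"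
        using n qbinom_eq[OF Q, of "nat (n + int N)" "nat (1 - n + int N)"]
        unfolding f_def split[OF n] by simp
    qed
    ultimately show "f n \<longlonglongrightarrow> w n / qpoch_inf Q"
      by (subst (asm) tendsto_cong) (auto simp: qpoch_inf_nonzero Q)
    fix N
    show "norm (f n N) \<le> C * norm (w n)"
    proof (cases "n \<in> {-int N..int N + 1}")
      case True
      then show ?thesis
        using C[of "nat (n + int N)" "nat (1 - n + int N)"]
        unfolding f_def split[OF True] by (auto simp: norm_mult mult_right_mono)
    next
      case False
      moreover have "C \<ge> 0"
        using C[of 0 0] norm_ge_zero order_trans by blast
      ultimately show ?thesis
        by (auto simp: f_def)
    qed
  qed (intro summable_on_cmult_right w)
  also have "(\<lambda>N. \<Sum>\<^sub>\<infinity>n. f n N) =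
      (\<lambda>N. \<Sum>n\<in>{-int N..int N + 1}. qbinom Q (2 * N + 1) (nat (n + int N)) * w n)"
  proof
    fix N
    have "(\<Sum>\<^sub>\<infinity>n. f n N) = (\<Sum>\<^sub>\<infinity>n\<in>{-int N..int N + 1}. f n N)"
      by (rule infsum_cong_neutral) (auto simp: f_def)
    also have "\<dots> = (\<Sum>n\<in>{-int N..int N + 1}. f n N)"
      by simp
    finally show "(\<Sum>\<^sub>\<infinity>n. f n N) =
      (\<Sum>n\<in>{-int N..int N + 1}. qbinom Q (2 * N + 1) (nat (n + int N)) * w n)"
      by (simp add: f_def)
  qed
  also have "(\<Sum>\<^sub>\<infinity>n. w n / qpoch_inf Q) = (\<Sum>\<^sub>\<infinity>n. w n) / qpoch_inf Q"
    by (simp add: divide_inverse infsum_cmult_left')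
  finally show ?thesis .
qed

section \<open>The finite triple product and its limits\<close>

lemma shifted_prod:
  fixes Q z :: complex
  assumes "Q \<noteq> 0" "z \<noteq> 0"
  shows "(\<Prod>i<2 * N + 1. 1 + z / Q ^ N * Q ^ i) = (\<Prod>k<N. z / Q ^ Suc k) *
     ((1 + z) * (\<Prod>k<N. (1 + z * Q ^ Suc k) * (1 + Q ^ Suc k / z)))" (is "_ = ?R N")
proof (induction N)
  case 0
  then show ?case by simp
next
  case (Suc N)
  have "(\<Prod>i<2 * Suc N + 1. 1 + z / Q ^ Suc N * Q ^ i)
      = (1 + z / Q ^ Suc N) * (\<Prod>i<Suc (2 * N + 1). 1 + z / Q ^ N * Q ^ i)"
    using prod.lessThan_Suc_shift[of "\<lambda>i. 1 + z / Q ^ Suc N * Q ^ i" "Suc (2 * N + 1)"] assms by simp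
  also have "(\<Prod>i<Suc (2 * N + 1). 1 + z / Q ^ N * Q ^ i) = ?R N * (1 + z * Q ^ Suc N)"
  proof -
    have "z / Q ^ N * Q ^ (2 * N + 1) = z * Q ^ Suc N"
      using assms by (simp add: mult_2 power_add)
    then show ?thesis
      unfolding prod.lessThan_Suc[of _ "2 * N + 1"] Suc.IH by simp
  qed
  \<comment> \<open>Passing from \<open>N\<close> to \<open>Suc N\<close> adds one factor at each
    end of the exponent range \<open>-N..N\<close>. The factor with negative exponent is inverted,
    and its leading part goes into the prefactor.\<close>
  also have "1 + z / Q ^ Suc N = z / Q ^ Suc N * (1 + Q ^ Suc N / z)"
    using assms by (simp add: field_simps)
  finally show ?case
    unfolding prod.lessThan_Suc[of _ N] by (simp only: mult_ac)
qed

lemma prefactor_prod: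
  fixes Q z :: complex
  assumes "Q \<noteq> 0"
  shows "(\<Prod>k<N. z / Q ^ Suc k) = z ^ N / Q ^ (Suc N choose 2)"
proof (induction N)
  case 0
  then show ?case by (simp add: numeral_2_eq_2)
next
  case (Suc N)
  show ?case
    unfolding prod.lessThan_Suc Suc.IH choose_two_Suc[of "Suc N"] using assms
    by (simp add: power_add mult_ac)
qed

lemma int_choose_two: "2 * int (k choose 2) = int k * (int k - 1)"
proof (induction k)
  case 0
  then show ?case by (simp add: numeral_2_eq_2)
next
  case (Suc k)
  then show ?case
    unfolding choose_two_Suc by (simp add: algebra_simps)
qed

text \<open>The q-binomial theorem with \<open>2 * N + 1\<close> factors at
  \<open>y = z / Q ^ N\<close>: the exponents of \<open>Q\<close> in the factors become
  \<open>-N..N\<close>, the middle one giving \<open>1 + z\<close>. The index shift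
  \<open>n = k - N\<close> recentres the sum, and the monomial \<open>?D\<close> common to both
  sides cancels.\<close>

lemma finite_jacobi_triple:
  assumes "Q \<noteq> 0" "z \<noteq> 0"
  shows "(1 + z) * (\<Prod>k<N. (1 + z * Q ^ Suc k) * (1 + Q ^ Suc k / z))
    = (\<Sum>n\<in>{-int N..int N + 1}. qbinom Q (2 * N + 1) (nat (n + int N)) * jacobi_term Q z n)"
proof -
  let ?D = "z ^ N / Q ^ (Suc N choose 2)"
  have factor: "Q ^ (k choose 2) * (z / Q ^ N) ^ k = ?D * jacobi_term Q z (int k - int N)" for k
  proof -
    let ?n = "int k - int N"
    \<comment> \<open>The exponent identity is checked after doubling, where triangular numbers
      become polynomials.\<close>
    have "2 * (int (k choose 2) - int (N * k) + int (Suc N choose 2)) = ?n * (?n - 1)"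
      unfolding distrib_left right_diff_distrib int_choose_two by (simp add: algebra_simps)
    then have e: "?n * (?n - 1) div 2 = int (k choose 2) - int (N * k) + int (Suc N choose 2)"
      by (metis nonzero_mult_div_cancel_left zero_neq_numeral)
    have "jacobi_term Q z ?n = z ^ k / z ^ N * (Q ^ (k choose 2) / Q ^ (N * k) * Q ^ (Suc N choose 2))"
      unfolding jacobi_term_def e using assms
      by (simp only: power_int_diff power_int_add power_int_of_nat simp_thms)
    then show ?thesis
      using assms by (simp add: power_divide power_mult)
  qed
  have "?D * ((1 + z) * (\<Prod>k<N. (1 + z * Q ^ Suc k) * (1 + Q ^ Suc k / z)))
      = (\<Sum>k\<le>2 * N + 1. Q ^ (k choose 2) * qbinom Q (2 * N + 1) k * (z / Q ^ N) ^ k)"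
    unfolding q_binomial_theorem[symmetric] shifted_prod[OF assms] prefactor_prod[OF assms(1)] ..
  also have "\<dots> = (\<Sum>k\<le>2 * N + 1. ?D * (qbinom Q (2 * N + 1) k * jacobi_term Q z (int k - int N)))"
  proof (rule sum.cong[OF refl])
    fix k
    show "Q ^ (k choose 2) * qbinom Q (2 * N + 1) k * (z / Q ^ N) ^ k
        = ?D * (qbinom Q (2 * N + 1) k * jacobi_term Q z (int k - int N))"
      using factor[of k] by (metis mult.assoc mult.left_commute)
  qed
  also have "\<dots> = ?D * (\<Sum>k\<le>2 * N + 1. qbinom Q (2 * N + 1) k * jacobi_term Q z (int k - int N))"
    by (simp only: sum_distrib_left)
  also have "(\<Sum>k\<le>2 * N + 1. qbinom Q (2 * N + 1) k * jacobi_term Q z (int k - int N))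
      = (\<Sum>n\<in>{-int N..int N + 1}. qbinom Q (2 * N + 1) (nat (n + int N)) * jacobi_term Q z n)"
    by (rule sum.reindex_bij_witness[of _ "\<lambda>n. nat (n + int N)" "\<lambda>k. int k - int N"]) auto
  finally show ?thesis
    using assms by simp
qed

text \<open>The factor \<open>qpoch_fin Q N\<close> cancels the denominator
  \<open>qpoch_inf Q\<close> left by the central coefficients. Keeping the product side as a limit
  of finite products lets each specialization simplify those before passing to the limit.\<close>

theorem jacobi_triple_product:
  assumes "norm Q < 1" "Q \<noteq> 0" "z \<noteq> 0"
  shows "(\<lambda>N. (1 + z) * (\<Prod>k<N. (1 + z * Q ^ Suc k) * (1 + Q ^ Suc k / z)) * qpoch_fin Q N)
           \<longlonglongrightarrow> (\<Sum>\<^sub>\<infinity>n. jacobi_term Q z n)"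
proof -
  have "(\<lambda>N. (1 + z) * (\<Prod>k<N. (1 + z * Q ^ Suc k) * (1 + Q ^ Suc k / z)) * qpoch_fin Q N)
           \<longlonglongrightarrow> (\<Sum>\<^sub>\<infinity>n. jacobi_term Q z n) / qpoch_inf Q * qpoch_inf Q"
    unfolding finite_jacobi_triple[OF assms(2,3)]
    by (intro tendsto_mult qbinom_sum_tendsto jacobi_term_abs_summable qpoch_fin_tendsto assms)
  then show ?thesis
    by (simp add: qpoch_inf_nonzero assms)
qed

text \<open>Divide the finite triple product by \<open>1 + z\<close> and let \<open>z\<close> tend to \<open>-1\<close>.\<close>
lemma finite_jacobi_cube:
  assumes "Q \<noteq> 0"
  shows "(\<Sum>n\<in>{-int N..int N + 1}. qbinom Q (2 * N + 1) (nat (n + int N)) * (of_int n * jacobi_term Q (-1) n))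
     = - (qpoch_fin Q N ^ 2)"
proof -
  define c where "c = (\<lambda>n. qbinom Q (2 * N + 1) (nat (n + int N)) * Q powi (n * (n - 1) div 2))"
  define f where "f = (\<lambda>z. \<Sum>n\<in>{-int N..int N + 1}. c n * z powi n)"
  define g where "g = (\<lambda>z. \<Prod>k<N. (1 + z * Q ^ Suc k) * (1 + Q ^ Suc k / z))"
  have fg: "f z = (1 + z) * g z" if "z \<noteq> 0" for z
    using finite_jacobi_triple[OF assms that, of N]
    by (simp add: f_def g_def c_def jacobi_term_def mult_ac)
  have "(f has_field_derivative (\<Sum>n\<in>{-int N..int N + 1}. c n * (of_int n * (-1) powi (n - 1)))) (at (-1))"
    unfolding f_def by (auto intro!: derivative_eq_intros simp: mult_ac)
  \<comment> \<open>Since \<open>f (-1) = 0\<close>, the difference quotient of \<open>f\<close> at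
    -1 is \<open>g\<close> itself, which is continuous there.\<close>
  moreover have "(f has_field_derivative g (-1)) (at (-1))"
    unfolding has_field_derivative_iff
  proof (rule Lim_transform_eventually)
    have "isCont g (-1)"
      unfolding g_def by (intro continuous_intros) auto
    then show "(g \<longlongrightarrow> g (-1)) (at (-1))"
      by (simp add: isCont_def)
    have "\<forall>\<^sub>F z in at (-1). z \<noteq> 0 \<and> z \<noteq> (-1 :: complex)"
      by (intro eventually_conj eventually_neq_at_within)
    then show "\<forall>\<^sub>F z in at (-1). g z = (f z - f (-1)) / (z - (-1))"
    proof eventually_elim
      case (elim z)
      then have "1 + z \<noteq> 0"
        by (simp add: add_eq_0_iff)
      with elim show ?case
        by (simp add: fg add.commute)
    qed
  qed
  ultimately have "(\<Sum>n\<in>{-int N..int N + 1}. c n * (of_int n * (-1) powi (n - 1))) = g (-1)"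
    by (rule DERIV_unique)
  moreover have "g (-1) = qpoch_fin Q N ^ 2"
    by (simp add: g_def qpoch_fin_def power2_eq_square prod.distrib)
  moreover have "(-1 :: complex) powi (n - 1) = - ((-1) powi n)" for n
    by (simp add: power_int_diff)
  ultimately show ?thesis
    by (simp add: c_def jacobi_term_def sum_negf mult_ac minus_equation_iff[of _ "qpoch_fin Q N ^ 2"] eq_commute)
qed

text \<open>The finite identity has two limits: the series over \<open>qpoch_inf Q\<close>, and
  minus a square. Pairing \<open>n\<close> with \<open>1 - n\<close> turns the bilateral series into
  minus the classical \<open>\<Sum> (-1)^n (2n + 1) Q^(n(n+1)/2)\<close> over
  \<open>n \<ge> 0\<close>.\<close>

theorem jacobi_cube:
  assumes "norm Q < 1" "Q \<noteq> 0"
  shows "(\<Sum>\<^sub>\<infinity>n. of_int n * jacobi_term Q (-1) n) = - (qpoch_inf Q ^ 3)"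
proof -
  have "(\<lambda>N. - (qpoch_fin Q N ^ 2)) \<longlonglongrightarrow> (\<Sum>\<^sub>\<infinity>n. of_int n * jacobi_term Q (-1) n) / qpoch_inf Q"
    unfolding finite_jacobi_cube[OF assms(2), symmetric]
    by (intro qbinom_sum_tendsto jacobi_term_deriv_abs_summable assms) simp
  moreover have "(\<lambda>N. - (qpoch_fin Q N ^ 2)) \<longlonglongrightarrow> - (qpoch_inf Q ^ 2)"
    by (intro tendsto_intros qpoch_fin_tendsto assms)
  ultimately have "(\<Sum>\<^sub>\<infinity>n. of_int n * jacobi_term Q (-1) n) / qpoch_inf Q = - (qpoch_inf Q ^ 2)"
    by (rule LIMSEQ_unique)
  then show ?thesis
    using qpoch_inf_nonzero[OF assms(1)] by (simp add: field_simps power2_eq_square power3_eq_cube)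
qed

section \<open>Bilinear relations of theta series\<close>

lemma infsum_product_eq:
  fixes f g :: "int \<Rightarrow> complex"
  assumes f: "(\<lambda>n. norm (f n)) summable_on UNIV" and g: "(\<lambda>n. norm (g n)) summable_on UNIV"
  shows "(\<lambda>(m, n). f m * g n) summable_on UNIV"
    and "(\<Sum>\<^sub>\<infinity>(m, n). f m * g n) = (\<Sum>\<^sub>\<infinity>m. f m) * (\<Sum>\<^sub>\<infinity>n. g n)"
proof -
  have "(\<lambda>p. norm (case p of (m, n) \<Rightarrow> f m * g n)) summable_on (UNIV \<times> UNIV)"
  proof (subst Infinite_Sum.abs_summable_on_Sigma_iff, intro conjI ballI)
    fix m
    show "(\<lambda>n. norm (case (m, n) of (m, n) \<Rightarrow> f m * g n)) summable_on UNIV"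
      using g by (auto simp: norm_mult intro: summable_on_cmult_right)
  next
    have "(\<lambda>m. norm (f m) * (\<Sum>\<^sub>\<infinity>n. norm (g n))) summable_on UNIV"
      by (intro summable_on_cmult_left f)
    also have "(\<lambda>m. norm (f m) * (\<Sum>\<^sub>\<infinity>n. norm (g n))) = (\<lambda>m. norm (\<Sum>\<^sub>\<infinity>n. norm (f m * g n)))"
      by (simp add: norm_mult infsum_cmult_right' infsum_nonneg)
    finally show "(\<lambda>m. norm (\<Sum>\<^sub>\<infinity>n. norm (case (m, n) of (m, n) \<Rightarrow> f m * g n))) summable_on UNIV"
      by simp
  qed
  then have *: "(\<lambda>(m, n). f m * g n) summable_on (UNIV \<times> UNIV)"
    by (rule abs_summable_summable)
  then show "(\<lambda>(m, n). f m * g n) summable_on UNIV"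
    by simp
  have "(\<Sum>\<^sub>\<infinity>m. \<Sum>\<^sub>\<infinity>n. f m * g n) = (\<Sum>\<^sub>\<infinity>(m, n)\<in>UNIV \<times> UNIV. f m * g n)"
    by (rule infsum_Sigma'_banach) (use * in auto)
  then show "(\<Sum>\<^sub>\<infinity>(m, n). f m * g n) = (\<Sum>\<^sub>\<infinity>m. f m) * (\<Sum>\<^sub>\<infinity>n. g n)"
    by (simp add: infsum_cmult_right' infsum_cmult_left')
qed

text \<open>The map \<open>(a, b) \<mapsto> (a + b, a - b)\<close> is a bijection onto the pairs
  with even coordinate sum; lowering the second coordinate by 1 yields the pairs with odd
  sum.\<close>

lemma infsum_lattice_split:
  fixes G :: "int \<times> int \<Rightarrow> complex"
  assumes "G summable_on UNIV"
  shows "infsum G UNIV = (\<Sum>\<^sub>\<infinity>(a, b). G (a + b, a - b)) + (\<Sum>\<^sub>\<infinity>(a, b). G (a + b, a - b - 1))"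
proof -
  define e o' where "e = (\<lambda>(a :: int, b :: int). (a + b, a - b))"
    and "o' = (\<lambda>(a :: int, b :: int). (a + b, a - b - 1))"
  have inj: "inj e" "inj o'"
    by (auto simp: inj_on_def e_def o'_def)
  have "p \<in> range e \<union> range o'" for p
  proof (cases p)
    case (Pair m n)
    show ?thesis
    proof (cases "even (m + n)")
      case True
      then have "p = e ((m + n) div 2, (m - n) div 2)"
        unfolding Pair e_def by auto presburger+
      then show ?thesis by blast
    next
      case False
      then have "p = o' ((m + n + 1) div 2, (m - n - 1) div 2)"
        unfolding Pair o'_def by auto presburger+
      then show ?thesis by blast
    qed
  qed
  then have un: "range e \<union> range o' = UNIV" by blast
  have disj: "range e \<inter> range o' = {}"
  proof -
    have "e p \<noteq> o' r" for p r
      by (cases p; cases r; simp add: e_def o'_def; presburger)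
    then show ?thesis by (metis (no_types, opaque_lifting) disjoint_iff rangeE)
  qed
  have "infsum G (range e \<union> range o') = infsum G (range e) + infsum G (range o')"
    by (intro infsum_Un_disjoint disj summable_on_subset[OF assms]) auto
  then show ?thesis
    unfolding un infsum_reindex[OF inj(1)] infsum_reindex[OF inj(2)]
    by (simp add: o_def e_def o'_def case_prod_unfold)
qed

lemma infsum_lattice_factor:
  fixes H :: "int \<times> int \<Rightarrow> complex"
  assumes "H summable_on UNIV"
    and "\<And>a b. H (a + b, a - b) = p a * r b"
    and "\<And>a b. H (a + b, a - b - 1) = p' a * r' b"
    and "(\<lambda>n. norm (p n)) summable_on UNIV" "(\<lambda>n. norm (r n)) summable_on UNIV"
    and "(\<lambda>n. norm (p' n)) summable_on UNIV" "(\<lambda>n. norm (r' n)) summable_on UNIV"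
  shows "infsum H UNIV = (\<Sum>\<^sub>\<infinity>n. p n) * (\<Sum>\<^sub>\<infinity>n. r n) + (\<Sum>\<^sub>\<infinity>n. p' n) * (\<Sum>\<^sub>\<infinity>n. r' n)"
  unfolding infsum_lattice_split[OF assms(1)] assms(2,3) using assms(4-7) by (simp add: infsum_product_eq)

section \<open>Theta series and their products\<close>

definition theta_term :: "complex \<Rightarrow> complex \<Rightarrow> int \<Rightarrow> complex" where
  "theta_term h w k = h powi (k\<^sup>2) * w powi k"

text \<open>The sums run over the exponents \<open>k \<equiv> d\<close> modulo 2, where \<open>h = exp (\<pi> \<i> \<tau> / 4)\<close>, that is
  \<open>h ^ 8 = q\<close>. Thus \<open>theta_sum 1 h w\<close> is \<open>\<theta>[1, \<epsilon>'](0, \<tau>)\<close> for \<open>w = exp (\<pi> \<i> \<epsilon>' / 2)\<close>.\<close>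
definition theta_sum :: "int \<Rightarrow> complex \<Rightarrow> complex \<Rightarrow> complex" where
  "theta_sum d h w = (\<Sum>\<^sub>\<infinity>n. theta_term h w (2 * n + d))"

text \<open>The termwise derivative \<open>w d/dw\<close> of \<open>theta_sum\<close>.\<close>

definition dtheta_sum :: "int \<Rightarrow> complex \<Rightarrow> complex \<Rightarrow> complex" where
  "dtheta_sum d h w = (\<Sum>\<^sub>\<infinity>n. of_int (2 * n + d) * theta_term h w (2 * n + d))"

text \<open>Completing the square:
  \<open>(2n + d)^2 = 8 * n(n-1)/2 + (4 + 4d) n + d^2\<close>.\<close>

lemma theta_term_conv_jacobi_term:
  assumes "h \<noteq> 0" "w \<noteq> 0"
  shows "theta_term h w (2 * n + d) = h powi (d\<^sup>2) * w powi d * jacobi_term (h ^ 8) (w\<^sup>2 * h powi (4 + 4 * d)) n"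
proof -
  have "2 * (n * (n - 1) div 2) = n * (n - 1)"
    by simp
  moreover have "4 * (n * (n - 1)) = 4 * n\<^sup>2 - 4 * n"
    by (simp add: power2_eq_square algebra_simps)
  ultimately have e: "8 * (n * (n - 1) div 2) = 4 * n\<^sup>2 - 4 * n"
    by linarith
  have "jacobi_term (h ^ 8) (w\<^sup>2 * h powi (4 + 4 * d)) n
      = w powi (2 * n) * h powi ((4 + 4 * d) * n) * h powi (4 * n\<^sup>2 - 4 * n)"
    unfolding jacobi_term_def power_int_mult_distrib power_int_power power_int_mult[symmetric] e[symmetric]
    by simp
  also have "\<dots> = w powi (2 * n) * h powi ((4 + 4 * d) * n + (4 * n\<^sup>2 - 4 * n))"
    unfolding power_int_add[OF disjI1[OF assms(1)]] by simp
  finally have "h powi (d\<^sup>2) * w powi d * jacobi_term (h ^ 8) (w\<^sup>2 * h powi (4 + 4 * d)) n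
      = h powi (d\<^sup>2 + ((4 + 4 * d) * n + (4 * n\<^sup>2 - 4 * n))) * w powi (2 * n + d)"
    using assms by (simp add: power_int_add)
  also have "d\<^sup>2 + ((4 + 4 * d) * n + (4 * n\<^sup>2 - 4 * n)) = (2 * n + d)\<^sup>2"
    by (simp add: power2_eq_square algebra_simps)
  finally show ?thesis
    by (simp add: theta_term_def)
qed

lemma norm_power_less_1: "norm (h :: complex) < 1 \<Longrightarrow> 0 < k \<Longrightarrow> norm (h ^ k) < 1"
  by (simp add: norm_power power_less_one_iff)

lemma theta_term_abs_summable:
  assumes "norm h < 1" "h \<noteq> 0" "w \<noteq> 0"
  shows "(\<lambda>n. norm (theta_term h w (2 * n + d))) summable_on UNIV"
  unfolding theta_term_conv_jacobi_term[OF assms(2,3)] norm_mult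
  by (intro summable_on_cmult_right jacobi_term_abs_summable norm_power_less_1) (use assms in auto)

lemma dtheta_term_abs_summable:
  assumes "norm h < 1" "h \<noteq> 0" "w \<noteq> 0"
  shows "(\<lambda>n. norm (of_int (2 * n + d) * theta_term h w (2 * n + d))) summable_on UNIV"
proof (rule summable_on_comparison_test)
  let ?j = "jacobi_term (h ^ 8) (w\<^sup>2 * h powi (4 + 4 * d))"
  let ?c = "norm (h powi (d\<^sup>2) * w powi d)"
  show "(\<lambda>n. ?c * (2 * norm (of_int n * ?j n) + norm (of_int d :: complex) * norm (?j n))) summable_on UNIV"
    by (intro summable_on_cmult_right summable_on_add jacobi_term_abs_summable jacobi_term_deriv_abs_summable
        norm_power_less_1) (use assms in auto)
  fix n
  have "norm (of_int (2 * n + d) :: complex) \<le> 2 * norm (of_int n :: complex) + norm (of_int d :: complex)"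
    using norm_triangle_ineq[of "2 * of_int n :: complex" "of_int d"] by (simp add: norm_mult)
  then have "norm (of_int (2 * n + d) :: complex) * (?c * norm (?j n))
      \<le> (2 * norm (of_int n :: complex) + norm (of_int d :: complex)) * (?c * norm (?j n))"
    by (rule mult_right_mono) auto
  then show "norm (of_int (2 * n + d) * theta_term h w (2 * n + d))
      \<le> ?c * (2 * norm (of_int n * ?j n) + norm (of_int d :: complex) * norm (?j n))"
    unfolding theta_term_conv_jacobi_term[OF assms(2,3)] norm_mult by (simp add: algebra_simps)
qed auto

text \<open>The parallelogram law \<open>(s + t)^2 + (s - t)^2 = 2 s^2 + 2 t^2\<close> separates the
  variables and squares \<open>h\<close>.\<close>

lemma theta_term_mult:
  assumes "h \<noteq> 0" "w \<noteq> 0" "v \<noteq> 0"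
  shows "theta_term h w (s + t) * theta_term h v (s - t) = theta_term (h\<^sup>2) (w * v) s * theta_term (h\<^sup>2) (w / v) t"
proof -
  have "h powi ((s + t)\<^sup>2) * h powi ((s - t)\<^sup>2) = h powi (2 * s\<^sup>2) * h powi (2 * t\<^sup>2)"
    using assms by (simp flip: power_int_add) (simp add: power2_eq_square algebra_simps)
  then show ?thesis
    using assms unfolding theta_term_def power_int_power
    by (simp add: power_int_add power_int_diff power_int_mult_distrib power_int_divide_distrib field_simps)
qed

text \<open>For odd \<open>k = s + t\<close> and \<open>l = s - t\<close> the numbers
  \<open>s\<close> and \<open>t\<close> have opposite parity; the two cosets of the rotated lattice
  are the two ways to distribute the parities.\<close>

lemma theta_sum_odd_mult:
  assumes "norm h < 1" "h \<noteq> 0" "w \<noteq> 0" "v \<noteq> 0"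
  shows "theta_sum 1 h w * theta_sum 1 h v
    = theta_sum 1 (h\<^sup>2) (w * v) * theta_sum 0 (h\<^sup>2) (w / v) + theta_sum 0 (h\<^sup>2) (w * v) * theta_sum 1 (h\<^sup>2) (w / v)"
proof -
  note sm = theta_term_abs_summable norm_power_less_1
  let ?f = "\<lambda>n. theta_term h w (2 * n + 1)" and ?g = "\<lambda>n. theta_term h v (2 * n + 1)"
  have "theta_sum 1 h w * theta_sum 1 h v = (\<Sum>\<^sub>\<infinity>(m, n). ?f m * ?g n)"
    unfolding theta_sum_def by (subst infsum_product_eq(2)) (use sm assms in auto)
  also have "\<dots> = (\<Sum>\<^sub>\<infinity>n. theta_term (h\<^sup>2) (w * v) (2 * n + 1)) * (\<Sum>\<^sub>\<infinity>n. theta_term (h\<^sup>2) (w / v) (2 * n + 0))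
      + (\<Sum>\<^sub>\<infinity>n. theta_term (h\<^sup>2) (w * v) (2 * n + 0)) * (\<Sum>\<^sub>\<infinity>n. theta_term (h\<^sup>2) (w / v) (2 * n + 1))"
  proof (rule infsum_lattice_factor)
    show "(\<lambda>(m, n). ?f m * ?g n) summable_on UNIV"
      by (intro infsum_product_eq sm assms)
    fix a b :: int
    show "(case (a + b, a - b) of (m, n) \<Rightarrow> ?f m * ?g n)
        = theta_term (h\<^sup>2) (w * v) (2 * a + 1) * theta_term (h\<^sup>2) (w / v) (2 * b + 0)"
      unfolding theta_term_mult[OF assms(2-4), symmetric] by (simp add: algebra_simps)
    show "(case (a + b, a - b - 1) of (m, n) \<Rightarrow> ?f m * ?g n)
        = theta_term (h\<^sup>2) (w * v) (2 * a + 0) * theta_term (h\<^sup>2) (w / v) (2 * b + 1)"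
      unfolding theta_term_mult[OF assms(2-4), symmetric] by (simp add: algebra_simps)
  qed (intro sm; use assms in simp)+
  finally show ?thesis
    by (simp add: theta_sum_def)
qed

lemma infsum_int_shift: "(\<Sum>\<^sub>\<infinity>n. f (n + c :: int)) = (\<Sum>\<^sub>\<infinity>n. f n)"
  by (rule infsum_reindex_bij_witness[of _ "\<lambda>n. n - c" "\<lambda>n. n + c"]) auto

lemma infsum_int_reflect: "(\<Sum>\<^sub>\<infinity>n. f (c - n :: int)) = (\<Sum>\<^sub>\<infinity>n. f n)"
  by (rule infsum_reindex_bij_witness[of _ "\<lambda>n. c - n" "\<lambda>n. c - n"]) auto

text \<open>For even \<open>k\<close> and \<open>l\<close> the numbers \<open>s\<close> and
  \<open>t\<close> have equal parity. The odd coset first appears with residue -1 in one factor,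
  which an index shift turns into 1.\<close>

lemma theta_sum_even_mult:
  assumes "norm h < 1" "h \<noteq> 0" "w \<noteq> 0" "v \<noteq> 0"
  shows "theta_sum 0 h w * theta_sum 0 h v
    = theta_sum 0 (h\<^sup>2) (w * v) * theta_sum 0 (h\<^sup>2) (w / v) + theta_sum 1 (h\<^sup>2) (w * v) * theta_sum 1 (h\<^sup>2) (w / v)"
proof -
  note sm = theta_term_abs_summable norm_power_less_1
  let ?f = "\<lambda>n. theta_term h w (2 * n + 0)" and ?g = "\<lambda>n. theta_term h v (2 * n + 0)"
  have "theta_sum 0 h w * theta_sum 0 h v = (\<Sum>\<^sub>\<infinity>(m, n). ?f m * ?g n)"
    unfolding theta_sum_def by (subst infsum_product_eq(2)) (use sm[of h] assms in blast)+
  also have "\<dots> = (\<Sum>\<^sub>\<infinity>n. theta_term (h\<^sup>2) (w * v) (2 * n + 0)) * (\<Sum>\<^sub>\<infinity>n. theta_term (h\<^sup>2) (w / v) (2 * n + 0))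
      + (\<Sum>\<^sub>\<infinity>n. theta_term (h\<^sup>2) (w * v) (2 * n + -1)) * (\<Sum>\<^sub>\<infinity>n. theta_term (h\<^sup>2) (w / v) (2 * n + 1))"
  proof (rule infsum_lattice_factor)
    show "(\<lambda>(m, n). ?f m * ?g n) summable_on UNIV"
      by (intro infsum_product_eq sm assms)
    fix a b :: int
    show "(case (a + b, a - b) of (m, n) \<Rightarrow> ?f m * ?g n)
        = theta_term (h\<^sup>2) (w * v) (2 * a + 0) * theta_term (h\<^sup>2) (w / v) (2 * b + 0)"
      unfolding theta_term_mult[OF assms(2-4), symmetric] by (simp add: algebra_simps)
    show "(case (a + b, a - b - 1) of (m, n) \<Rightarrow> ?f m * ?g n)
        = theta_term (h\<^sup>2) (w * v) (2 * a + -1) * theta_term (h\<^sup>2) (w / v) (2 * b + 1)"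
      unfolding theta_term_mult[OF assms(2-4), symmetric] by (simp add: algebra_simps)
  qed (intro sm; use assms in simp)+
  also have "(\<Sum>\<^sub>\<infinity>n. theta_term (h\<^sup>2) (w * v) (2 * n + -1)) = (\<Sum>\<^sub>\<infinity>n. theta_term (h\<^sup>2) (w * v) (2 * n + 1))"
    by (subst (2) infsum_int_shift[symmetric, of _ "-1"]) (simp add: algebra_simps)
  finally show ?thesis
    by (simp add: theta_sum_def)
qed

section \<open>Symmetries in \<open>w\<close> and the resulting zeros\<close>

lemma theta_term_reflect: "theta_term h (1 / w) (- k) = theta_term h w k"
  by (simp add: theta_term_def power_int_minus power_int_divide_distrib)

text \<open>The substitution \<open>n \<mapsto> - d - n\<close> negates the exponent
  \<open>2 * n + d\<close>. The terms are invariant under negating the exponent and inverting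
  \<open>w\<close>, while the weight of the derivative changes sign.\<close>

lemma
  assumes "d \<in> {0, 1}"
  shows theta_sum_reflect: "theta_sum d h (1 / w) = theta_sum d h w"
    and dtheta_sum_reflect: "dtheta_sum d h (1 / w) = - dtheta_sum d h w"
proof -
  have e: "2 * (- d - n) + d = - (2 * n + d)" for n
    by simp
  show "theta_sum d h (1 / w) = theta_sum d h w"
    unfolding theta_sum_def infsum_int_reflect[of "\<lambda>n. theta_term h (1 / w) (2 * n + d)" "-d", symmetric] e theta_term_reflect ..
  show "dtheta_sum d h (1 / w) = - dtheta_sum d h w"
    unfolding dtheta_sum_def e theta_term_reflect infsum_uminus[symmetric]
      infsum_int_reflect[of "\<lambda>n. of_int (2 * n + d) * theta_term h (1 / w) (2 * n + d)" "-d", symmetric]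
    by (simp add: algebra_simps)
qed

lemma theta_term_minus: "theta_term h (- w) k = (if even k then 1 else -1) * theta_term h w k"
  by (simp add: theta_term_def power_int_minus_left)

lemma theta_sum_minus: "theta_sum 0 h (- w) = theta_sum 0 h w" "theta_sum 1 h (- w) = - theta_sum 1 h w"
  by (simp_all add: theta_sum_def theta_term_minus infsum_uminus)

lemma dtheta_sum_minus: "dtheta_sum 0 h (- w) = dtheta_sum 0 h w"
  by (simp add: dtheta_sum_def theta_term_minus)

text \<open>Because \<open>1 / \<i> = - \<i>\<close>, reflection and the parity in \<open>w\<close>
  give the value at \<open>- \<i>\<close> opposite signs. The derivative series over even exponents
  vanishes at \<open>\<i>\<close> for the same reason.\<close>

lemma theta_sum_1_i: "theta_sum 1 h \<i> = 0"
  using theta_sum_reflect[of 1 h \<i>] theta_sum_minus(2)[of h \<i>] by simp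

lemma dtheta_sum_0_i: "dtheta_sum 0 h \<i> = 0"
  using dtheta_sum_reflect[of 0 h \<i>] dtheta_sum_minus[of h \<i>] by simp

section \<open>The derivative in \<open>\<tau>\<close> and the Wronskian\<close>

definition d2theta_sum :: "complex \<Rightarrow> complex \<Rightarrow> complex" where
  "d2theta_sum h w = (\<Sum>\<^sub>\<infinity>n. of_int ((2 * n + 1)\<^sup>2) * theta_term h w (2 * n + 1))"

lemma theta_term_exp: "theta_term (exp x) w k = exp (of_int (k\<^sup>2) * x) * w powi k"
  by (simp add: theta_term_def exp_power_int)

text \<open>The heat equation: differentiating in \<open>\<tau>\<close> brings down \<open>c\<close>
  times the squared exponent of \<open>w\<close>. Partial sums converge uniformly on a disc, so
  holomorphic limits may be differentiated termwise.\<close>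

lemma
  assumes "Im \<tau> > 0" "w \<noteq> 0"
  defines "c \<equiv> pi * \<i> / 4"
  shows theta_sum_has_derivative:
      "((\<lambda>t. theta_sum 1 (exp (c * t)) w) has_field_derivative c * d2theta_sum (exp (c * \<tau>)) w) (at \<tau>)"
    and d2theta_sum_abs_summable:
      "(\<lambda>n. norm (of_int ((2 * n + 1)\<^sup>2) * theta_term (exp (c * \<tau>)) w (2 * n + 1))) summable_on UNIV"
proof -
  \<comment> \<open>On the closed disc of this radius \<open>Im t \<ge> r\<close>, so every term is
    dominated by the one at the real nome \<open>h\<^sub>0 = exp (- pi * r / 4)\<close>.\<close>
  define r where "r = Im \<tau> / 2"
  define h\<^sub>0 :: complex where "h\<^sub>0 = of_real (exp (- pi * r / 4))"
  have r: "r > 0"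
    using assms by (simp add: r_def)
  have h0: "norm h\<^sub>0 < 1" "h\<^sub>0 \<noteq> 0"
    using r by (simp_all add: h\<^sub>0_def)
  have le: "norm (theta_term (exp (c * t)) w k) \<le> norm (theta_term h\<^sub>0 w k)" if "t \<in> cball \<tau> r" for t k
  proof -
    have "\<bar>Im (\<tau> - t)\<bar> \<le> r"
      using that abs_Im_le_cmod[of "\<tau> - t"] by (simp add: dist_norm)
    then have "Im t \<ge> r"
      unfolding r_def minus_complex.sel by linarith
    then have "norm (exp (c * t)) \<le> norm h\<^sub>0"
      by (simp add: c_def h\<^sub>0_def)
    then have "norm (exp (c * t)) powi (k\<^sup>2) \<le> norm h\<^sub>0 powi (k\<^sup>2)"
      by (intro power_int_mono) auto
    then show ?thesis
      by (simp add: theta_term_def norm_mult norm_power_int mult_right_mono)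
  qed
  have ul: "uniform_limit (cball \<tau> r) (\<lambda>X t. \<Sum>n\<in>X. theta_term (exp (c * t)) w (2 * n + 1))
      (\<lambda>t. theta_sum 1 (exp (c * t)) w) (finite_subsets_at_top UNIV)"
    unfolding theta_sum_def
    by (rule Weierstrass_m_test_general[OF _ theta_term_abs_summable[OF h0 assms(2), of 1]]) (use le in auto)
  have ev: "\<forall>\<^sub>F X in finite_subsets_at_top UNIV.
      continuous_on (cball \<tau> r) (\<lambda>t. \<Sum>n\<in>X. theta_term (exp (c * t)) w (2 * n + 1)) \<and>
      (\<forall>t\<in>ball \<tau> r. ((\<lambda>t. \<Sum>n\<in>X. theta_term (exp (c * t)) w (2 * n + 1)) has_field_derivative
        (\<Sum>n\<in>X. c * (of_int ((2 * n + 1)\<^sup>2) * theta_term (exp (c * t)) w (2 * n + 1)))) (at t))"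
    unfolding theta_term_exp
    by (intro always_eventually allI conjI ballI continuous_intros)
      (auto intro!: derivative_eq_intros sum.cong simp: mult_ac)
  obtain g' where g': "\<And>t. t \<in> ball \<tau> r \<Longrightarrow>
      ((\<lambda>t. theta_sum 1 (exp (c * t)) w) has_field_derivative g' t) (at t) \<and>
      ((\<lambda>X. \<Sum>n\<in>X. c * (of_int ((2 * n + 1)\<^sup>2) * theta_term (exp (c * t)) w (2 * n + 1))) \<longlongrightarrow> g' t)
        (finite_subsets_at_top UNIV)"
    using has_complex_derivative_uniform_limit[OF ev ul _ r] by auto
  have d: "((\<lambda>t. theta_sum 1 (exp (c * t)) w) has_field_derivative g' \<tau>) (at \<tau>)"
    and hs: "((\<lambda>n. c * (of_int ((2 * n + 1)\<^sup>2) * theta_term (exp (c * \<tau>)) w (2 * n + 1))) has_sum g' \<tau>) UNIV"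
    using g'[of \<tau>] r by (auto simp: has_sum_def)
  have "c \<noteq> 0"
    by (simp add: c_def)
  have "(\<lambda>n. c * (of_int ((2 * n + 1)\<^sup>2) * theta_term (exp (c * \<tau>)) w (2 * n + 1))) summable_on UNIV"
    using hs by (rule has_sum_imp_summable)
  \<comment> \<open>Convergence of the differentiated partial sums already yields summability of the
    weighted series; for complex terms this is absolute summability, so no separate estimate
    enters.\<close>
  then have "(\<lambda>n. of_int ((2 * n + 1)\<^sup>2) * theta_term (exp (c * \<tau>)) w (2 * n + 1)) summable_on UNIV"
    using \<open>c \<noteq> 0\<close> by (simp add: summable_on_cmult_right')
  then show "(\<lambda>n. norm (of_int ((2 * n + 1)\<^sup>2) * theta_term (exp (c * \<tau>)) w (2 * n + 1))) summable_on UNIV"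
    by (simp only: summable_on_iff_abs_summable_on_complex)
  have "g' \<tau> = c * d2theta_sum (exp (c * \<tau>)) w"
    using infsumI[OF hs] by (simp add: d2theta_sum_def infsum_cmult_right')
  with d show "((\<lambda>t. theta_sum 1 (exp (c * t)) w) has_field_derivative c * d2theta_sum (exp (c * \<tau>)) w) (at \<tau>)"
    by simp
qed

text \<open>The rotation \<open>(k, l) = (s + t, s - t)\<close> turns the weight \<open>k\<^sup>2 - l\<^sup>2\<close> into \<open>4 s t\<close>,
  so that the Wronskian factors into products of first derivatives.\<close>
lemma theta_sum_wronskian:
  assumes h: "norm h < 1" "h \<noteq> 0" and w: "w \<noteq> 0" and v: "v \<noteq> 0"
    and sw: "(\<lambda>n. norm (of_int ((2 * n + 1)\<^sup>2) * theta_term h w (2 * n + 1))) summable_on UNIV"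
    and sv: "(\<lambda>n. norm (of_int ((2 * n + 1)\<^sup>2) * theta_term h v (2 * n + 1))) summable_on UNIV"
  shows "d2theta_sum h w * theta_sum 1 h v - theta_sum 1 h w * d2theta_sum h v
    = 4 * (dtheta_sum 1 (h\<^sup>2) (w * v) * dtheta_sum 0 (h\<^sup>2) (w / v) + dtheta_sum 0 (h\<^sup>2) (w * v) * dtheta_sum 1 (h\<^sup>2) (w / v))"
proof -
  let ?f = "\<lambda>n. theta_term h w (2 * n + 1)" and ?g = "\<lambda>n. theta_term h v (2 * n + 1)"
  let ?F = "\<lambda>n. of_int ((2 * n + 1)\<^sup>2) * ?f n" and ?G = "\<lambda>n. of_int ((2 * n + 1)\<^sup>2) * ?g n"
  let ?p = "\<lambda>d z n. of_int (2 * n + d) * theta_term (h\<^sup>2) z (2 * n + d)"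
  note sf = theta_term_abs_summable[OF h w, of 1] and sg = theta_term_abs_summable[OF h v, of 1]
  note P1 = infsum_product_eq[OF sw sg] and P2 = infsum_product_eq[OF sf sv]
  have sp: "(\<lambda>n. norm (?p d z n)) summable_on UNIV" if "z \<noteq> 0" for d z
    by (rule dtheta_term_abs_summable[OF norm_power_less_1]) (use h that in auto)
  have sp4: "(\<lambda>n. norm (4 * ?p d z n)) summable_on UNIV" if "z \<noteq> 0" for d z
    using summable_on_cmult_right[OF sp[OF that], of 4 d] by (simp only: norm_mult norm_numeral)
  define H where "H = (\<lambda>p. (case p of (m, n) \<Rightarrow> ?F m * ?g n) + - (case p of (m, n) \<Rightarrow> ?f m * ?G n))"
  have H: "H (m, n) = of_int ((2 * m + 1)\<^sup>2 - (2 * n + 1)\<^sup>2) * (?f m * ?g n)" for m n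
    by (simp add: H_def algebra_simps)
  have "infsum H UNIV = d2theta_sum h w * theta_sum 1 h v - theta_sum 1 h w * d2theta_sum h v"
    unfolding H_def theta_sum_def d2theta_sum_def P1(2)[symmetric] P2(2)[symmetric]
    by (subst infsum_add[OF P1(1) summable_on_uminus[THEN iffD2, OF P2(1)]])
      (simp only: infsum_uminus diff_conv_add_uminus)
  moreover have "infsum H UNIV = (\<Sum>\<^sub>\<infinity>n. 4 * ?p 1 (w * v) n) * (\<Sum>\<^sub>\<infinity>n. ?p 0 (w / v) n)
      + (\<Sum>\<^sub>\<infinity>n. 4 * ?p 0 (w * v) n) * (\<Sum>\<^sub>\<infinity>n. ?p 1 (w / v) n)"
  proof (rule infsum_lattice_factor)
    show "H summable_on UNIV"
      unfolding H_def by (intro summable_on_add summable_on_uminus[THEN iffD2] P1(1) P2(1))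
    fix a b :: int
    have "(2 * (a + b) + 1)\<^sup>2 - (2 * (a - b) + 1)\<^sup>2 = 4 * ((2 * a + 1) * (2 * b + 0))"
      by (simp add: power2_eq_square algebra_simps)
    moreover have "?f (a + b) * ?g (a - b)
        = theta_term (h\<^sup>2) (w * v) (2 * a + 1) * theta_term (h\<^sup>2) (w / v) (2 * b + 0)"
      unfolding theta_term_mult[OF h(2) w v, symmetric] by (simp add: algebra_simps)
    ultimately show "H (a + b, a - b) = 4 * ?p 1 (w * v) a * ?p 0 (w / v) b"
      unfolding H by simp
    have "(2 * (a + b) + 1)\<^sup>2 - (2 * (a - b - 1) + 1)\<^sup>2 = 4 * ((2 * a + 0) * (2 * b + 1))"
      by (simp add: power2_eq_square algebra_simps)
    moreover have "?f (a + b) * ?g (a - b - 1)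
        = theta_term (h\<^sup>2) (w * v) (2 * a + 0) * theta_term (h\<^sup>2) (w / v) (2 * b + 1)"
      unfolding theta_term_mult[OF h(2) w v, symmetric] by (simp add: algebra_simps)
    ultimately show "H (a + b, a - b - 1) = 4 * ?p 0 (w * v) a * ?p 1 (w / v) b"
      unfolding H by simp
  qed (intro sp sp4; use w v in simp)+
  ultimately show ?thesis
    by (simp only: infsum_cmult_right' dtheta_sum_def[symmetric]) (simp add: algebra_simps)
qed

section \<open>Evaluation of the derivative series\<close>

lemma infsum_even_odd:
  fixes f :: "int \<Rightarrow> complex"
  assumes "f summable_on UNIV"
  shows "(\<Sum>\<^sub>\<infinity>n. f n) = (\<Sum>\<^sub>\<infinity>n. f (2 * n)) + (\<Sum>\<^sub>\<infinity>n. f (2 * n + 1))"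
proof -
  let ?e = "\<lambda>n :: int. 2 * n" and ?o = "\<lambda>n :: int. 2 * n + 1"
  have un: "range ?e \<union> range ?o = UNIV"
    by (auto simp: image_iff) presburger
  have disj: "range ?e \<inter> range ?o = {}"
    by auto presburger
  have "infsum f (range ?e \<union> range ?o) = infsum f (range ?e) + infsum f (range ?o)"
    by (intro infsum_Un_disjoint disj summable_on_subset[OF assms]) auto
  then show ?thesis
    unfolding un by (simp add: infsum_reindex inj_on_def o_def)
qed

text \<open>The even exponents are \<open>2 * k\<close> with \<open>k\<close> of either parity.
  Doubling the exponent amounts to \<open>h \<mapsto> h ^ 4\<close>,
  \<open>w \<mapsto> w\<^sup>2\<close>, and the weight contributes the factor 2.\<close>

lemma dtheta_sum_0_split:
  assumes "norm h < 1" "h \<noteq> 0" "w \<noteq> 0"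
  shows "dtheta_sum 0 h w = 2 * (dtheta_sum 0 (h ^ 4) (w\<^sup>2) + dtheta_sum 1 (h ^ 4) (w\<^sup>2))"
proof -
  have tt2: "theta_term h w (2 * k) = theta_term (h ^ 4) (w\<^sup>2) k" for k
    unfolding theta_term_def power_int_power by (simp add: power_mult_distrib)
  define f where "f = (\<lambda>n. of_int (2 * n + 0) * theta_term h w (2 * n + 0))"
  have f: "f n = 2 * (of_int n * theta_term (h ^ 4) (w\<^sup>2) n)" for n
    by (simp add: f_def tt2)
  have "f summable_on UNIV"
    unfolding f_def by (rule abs_summable_summable[OF dtheta_term_abs_summable[OF assms]])
  then have "(\<Sum>\<^sub>\<infinity>n. f n) = (\<Sum>\<^sub>\<infinity>n. f (2 * n)) + (\<Sum>\<^sub>\<infinity>n. f (2 * n + 1))"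
    by (rule infsum_even_odd)
  also have "(\<Sum>\<^sub>\<infinity>n. f (2 * n)) = 2 * dtheta_sum 0 (h ^ 4) (w\<^sup>2)"
    unfolding f infsum_cmult_right' dtheta_sum_def by simp
  also have "(\<Sum>\<^sub>\<infinity>n. f (2 * n + 1)) = 2 * dtheta_sum 1 (h ^ 4) (w\<^sup>2)"
    unfolding f infsum_cmult_right' dtheta_sum_def by simp
  also have "(\<Sum>\<^sub>\<infinity>n. f n) = dtheta_sum 0 h w"
    by (simp add: f_def dtheta_sum_def)
  finally show ?thesis
    by simp
qed

text \<open>The reflection \<open>n \<mapsto> 1 - n\<close> multiplies the terms by
  \<open>z = -1\<close>.\<close>

lemma infsum_jacobi_term_minus_one: "(\<Sum>\<^sub>\<infinity>n. jacobi_term Q (-1) n) = 0"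
proof -
  have "(\<Sum>\<^sub>\<infinity>n. jacobi_term Q (-1) n) = (\<Sum>\<^sub>\<infinity>n. jacobi_term Q (-1) (1 - n))"
    by (rule infsum_int_reflect[symmetric])
  also have "\<dots> = - (\<Sum>\<^sub>\<infinity>n. jacobi_term Q (-1) n)"
    by (simp add: jacobi_term_reflect infsum_uminus)
  finally show ?thesis
    by simp
qed

text \<open>After an index shift the weight is \<open>2 * n - 1\<close>. Its constant part meets the
  vanishing series at \<open>z = -1\<close>, and its linear part gives the cube of the Euler
  product.\<close>

lemma dtheta_sum_1_i:
  assumes "norm h < 1" "h \<noteq> 0"
  shows "dtheta_sum 1 h \<i> = 2 * \<i> * h * qpoch_inf (h ^ 8) ^ 3"
proof -
  let ?j = "jacobi_term (h ^ 8) (-1)"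
  have h8: "norm (h ^ 8) < 1" "h ^ 8 \<noteq> 0"
    using assms by (auto intro: norm_power_less_1)
  have term1: "theta_term h \<i> (2 * n + 1) = - (\<i> * h) * ?j (n + 1)" for n
  proof -
    have "?j (n + 1) = - jacobi_term (h ^ 8) (- (h ^ 8)) n"
      using jacobi_term_shift[OF _ h8(2), of "-1" n] by simp
    then show ?thesis
      using assms by (simp add: theta_term_conv_jacobi_term)
  qed
  have s1: "(\<lambda>n. of_int n * ?j n) summable_on UNIV" and s2: "?j summable_on UNIV"
    by (rule abs_summable_summable[OF jacobi_term_deriv_abs_summable[OF h8]] abs_summable_summable[OF jacobi_term_abs_summable[OF h8]], simp)+
  have "dtheta_sum 1 h \<i> = (\<Sum>\<^sub>\<infinity>n. of_int (2 * (n + 1) - 1) * (- (\<i> * h) * ?j (n + 1)))"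
    unfolding dtheta_sum_def term1 by (simp add: add.commute)
  also have "\<dots> = (\<Sum>\<^sub>\<infinity>n. of_int (2 * n - 1) * (- (\<i> * h) * ?j n))"
    by (rule infsum_int_shift[of "\<lambda>n. of_int (2 * n - 1) * (- (\<i> * h) * ?j n)" 1])
  also have "\<dots> = (\<Sum>\<^sub>\<infinity>n. (- (2 * \<i> * h)) * (of_int n * ?j n) + (\<i> * h) * ?j n)"
    by (simp add: algebra_simps)
  also have "\<dots> = (- (2 * \<i> * h)) * (\<Sum>\<^sub>\<infinity>n. of_int n * ?j n) + (\<i> * h) * (\<Sum>\<^sub>\<infinity>n. ?j n)"
    by (subst infsum_add) (intro summable_on_cmult_right s1 s2, intro summable_on_cmult_right s1 s2,
        simp only: infsum_cmult_right')
  finally show ?thesis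
    by (simp add: infsum_jacobi_term_minus_one jacobi_cube[OF h8])
qed

section \<open>Product formulas and the differential equation\<close>

lemma infsum_jacobi_term_shift:
  assumes "z \<noteq> 0" "Q \<noteq> 0"
  shows "(\<Sum>\<^sub>\<infinity>n. jacobi_term Q z n) = z * (\<Sum>\<^sub>\<infinity>n. jacobi_term Q (z * Q) n)"
  unfolding infsum_int_shift[of "jacobi_term Q z" 1, symmetric] jacobi_term_shift[OF assms] infsum_cmult_right' ..

text \<open>Shifting the index by one frees the argument from \<open>h\<close>. The triple product
  is thus taken at \<open>w\<^sup>2\<close>, which will be 1 or \<open>\<i>\<close>.\<close>

lemma theta_sum_1_conv_jacobi_term:
  assumes "h \<noteq> 0" "w \<noteq> 0"
  shows "theta_sum 1 h w = h / w * (\<Sum>\<^sub>\<infinity>n. jacobi_term (h ^ 8) (w\<^sup>2) n)"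
proof -
  have "theta_sum 1 h w = h * w * (\<Sum>\<^sub>\<infinity>n. jacobi_term (h ^ 8) (w\<^sup>2 * h ^ 8) n)"
    unfolding theta_sum_def theta_term_conv_jacobi_term[OF assms] infsum_cmult_right' by simp
  moreover have "(\<Sum>\<^sub>\<infinity>n. jacobi_term (h ^ 8) (w\<^sup>2) n) = w\<^sup>2 * (\<Sum>\<^sub>\<infinity>n. jacobi_term (h ^ 8) (w\<^sup>2 * h ^ 8) n)"
    using assms by (intro infsum_jacobi_term_shift) auto
  ultimately show ?thesis
    using assms by (simp add: power2_eq_square)
qed

lemma prod_one_plus: "(\<Prod>k<N. 1 + Q ^ Suc k) * qpoch_fin Q N = qpoch_fin (Q\<^sup>2) N"
  unfolding qpoch_fin_def prod.distrib[symmetric]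
  by (intro prod.cong refl) (simp add: algebra_simps power_mult_distrib flip: power2_eq_square power_mult)

lemma prod_one_plus_tendsto:
  assumes "norm Q < 1"
  shows "(\<lambda>N. \<Prod>k<N. 1 + Q ^ Suc k) \<longlonglongrightarrow> qpoch_inf (Q\<^sup>2) / qpoch_inf Q"
proof -
  have "(\<lambda>N. qpoch_fin (Q\<^sup>2) N / qpoch_fin Q N) \<longlonglongrightarrow> qpoch_inf (Q\<^sup>2) / qpoch_inf Q"
    by (intro tendsto_intros qpoch_fin_tendsto qpoch_inf_nonzero norm_power_less_1 assms) simp
  then show ?thesis
    using prod_one_plus[of Q] qpoch_fin_nonzero[OF assms] by (simp add: eq_divide_imp flip: prod_one_plus)
qed

text \<open>At \<open>z = 1\<close> the prefactor is 2 and the two factors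
  \<open>1 + z * Q ^ k\<close>, \<open>1 + Q ^ k / z\<close> coincide.\<close>

lemma infsum_jacobi_term_1:
  assumes "norm Q < 1" "Q \<noteq> 0"
  shows "(\<Sum>\<^sub>\<infinity>n. jacobi_term Q 1 n) = 2 * qpoch_inf (Q\<^sup>2) ^ 2 / qpoch_inf Q"
proof -
  have "(\<lambda>N. 2 * (\<Prod>k<N. 1 + Q ^ Suc k) ^ 2 * qpoch_fin Q N)
      \<longlonglongrightarrow> 2 * (qpoch_inf (Q\<^sup>2) / qpoch_inf Q) ^ 2 * qpoch_inf Q"
    by (intro tendsto_intros qpoch_fin_tendsto prod_one_plus_tendsto assms)
  moreover have "(\<lambda>N. 2 * (\<Prod>k<N. 1 + Q ^ Suc k) ^ 2 * qpoch_fin Q N) \<longlonglongrightarrow> (\<Sum>\<^sub>\<infinity>n. jacobi_term Q 1 n)"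
    using jacobi_triple_product[OF assms, of 1] by (simp add: prod.distrib power2_eq_square)
  ultimately show ?thesis
    using LIMSEQ_unique qpoch_inf_nonzero[OF assms(1)] by (fastforce simp: power2_eq_square)
qed

text \<open>At \<open>z = \<i>\<close> the cross terms cancel, as
  \<open>\<i> + 1 / \<i> = 0\<close>, and each pair of factors becomes
  \<open>1 + Q ^ (2 * k)\<close>.\<close>

lemma infsum_jacobi_term_i:
  assumes "norm Q < 1" "Q \<noteq> 0"
  shows "(\<Sum>\<^sub>\<infinity>n. jacobi_term Q \<i> n) = (1 + \<i>) * qpoch_inf (Q ^ 4) / qpoch_inf (Q\<^sup>2) * qpoch_inf Q"
proof -
  have "(1 + \<i> * Q ^ Suc k) * (1 + Q ^ Suc k / \<i>) = 1 + (Q\<^sup>2) ^ Suc k" for k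
    by (simp add: algebra_simps power_mult_distrib flip: power2_eq_square power_mult)
  then have "(\<lambda>N. (1 + \<i>) * (\<Prod>k<N. 1 + (Q\<^sup>2) ^ Suc k) * qpoch_fin Q N) \<longlonglongrightarrow> (\<Sum>\<^sub>\<infinity>n. jacobi_term Q \<i> n)"
    using jacobi_triple_product[OF assms, of \<i>] by simp
  moreover have "(\<lambda>N. (1 + \<i>) * (\<Prod>k<N. 1 + (Q\<^sup>2) ^ Suc k) * qpoch_fin Q N)
      \<longlonglongrightarrow> (1 + \<i>) * (qpoch_inf ((Q\<^sup>2)\<^sup>2) / qpoch_inf (Q\<^sup>2)) * qpoch_inf Q"
    by (intro tendsto_intros qpoch_fin_tendsto prod_one_plus_tendsto norm_power_less_1 assms) simp
  ultimately show ?thesis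
    using LIMSEQ_unique by fastforce
qed

text \<open>With base \<open>x\<^sup>2\<close> and \<open>z = - x\<close> both families of factors
  run over \<open>1 - x ^ k\<close> with \<open>k\<close> odd, and together with the even ones they
  fill up the Euler product of \<open>x\<close>.\<close>

lemma infsum_jacobi_term_square_minus:
  assumes "norm x < 1" "x \<noteq> 0"
  shows "(\<Sum>\<^sub>\<infinity>n. jacobi_term (x\<^sup>2) (- x) n) = qpoch_inf x ^ 2 / qpoch_inf (x\<^sup>2)"
proof -
  define p where "p = (\<lambda>N. \<Prod>k<N. 1 - x ^ (2 * k + 1))"
  have x2: "norm (x\<^sup>2) < 1" "x\<^sup>2 \<noteq> 0"
    using assms by (auto intro: norm_power_less_1)
  have p_qpoch_fin: "p N * qpoch_fin (x\<^sup>2) N = qpoch_fin x (2 * N)" for N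
    by (induction N) (simp_all add: p_def qpoch_fin_def power_mult power_mult_distrib power2_eq_square mult_ac)
  have "(1 - x) * (\<Prod>k<N. (1 + - x * (x\<^sup>2) ^ Suc k) * (1 + (x\<^sup>2) ^ Suc k / - x)) * qpoch_fin (x\<^sup>2) N
      = (1 - x ^ Suc (2 * N)) * qpoch_fin x (2 * N) ^ 2 / qpoch_fin (x\<^sup>2) N" for N
  proof -
    \<comment> \<open>This family starts at \<open>x ^ 3\<close>; the prefactor \<open>1 - x\<close>
      supplies the missing first factor, leaving one surplus factor at the end that tends to
      1.\<close>
    have "(1 - x) * (\<Prod>k<N. 1 + - x * (x\<^sup>2) ^ Suc k) = p N * (1 - x ^ Suc (2 * N))"
      by (induction N) (simp_all add: p_def power_mult power_mult_distrib power2_eq_square mult_ac)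
    moreover have "(\<Prod>k<N. 1 + (x\<^sup>2) ^ Suc k / - x) = p N"
      unfolding p_def using assms
      by (intro prod.cong refl) (simp add: power_mult power2_eq_square)
    ultimately show ?thesis
      using qpoch_fin_nonzero[OF x2(1), of N]
      by (simp add: prod.distrib power2_eq_square flip: p_qpoch_fin mult.assoc)
  qed
  then have "(\<lambda>N. (1 - x ^ Suc (2 * N)) * qpoch_fin x (2 * N) ^ 2 / qpoch_fin (x\<^sup>2) N)
      \<longlonglongrightarrow> (\<Sum>\<^sub>\<infinity>n. jacobi_term (x\<^sup>2) (- x) n)"
    using jacobi_triple_product[OF x2, of "- x"] assms(2) by simp
  moreover have "(\<lambda>N. (1 - x ^ Suc (2 * N)) * qpoch_fin x (2 * N) ^ 2 / qpoch_fin (x\<^sup>2) N)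
      \<longlonglongrightarrow> (1 - 0) * qpoch_inf x ^ 2 / qpoch_inf (x\<^sup>2)"
  proof (intro tendsto_intros qpoch_fin_tendsto x2 qpoch_inf_nonzero)
    show "(\<lambda>N. x ^ Suc (2 * N)) \<longlonglongrightarrow> 0"
      by (rule filterlim_compose[OF LIMSEQ_power_zero[OF assms(1)]], rule filterlim_at_top_mono[OF filterlim_ident]) simp
    show "(\<lambda>N. qpoch_fin x (2 * N)) \<longlonglongrightarrow> qpoch_inf x"
      by (rule filterlim_compose[OF qpoch_fin_tendsto[OF assms(1)]], rule filterlim_at_top_mono[OF filterlim_ident]) simp
  qed
  ultimately show ?thesis
    using LIMSEQ_unique by fastforce
qed

section \<open>Theta constants as quotients of Euler products\<close>

lemma theta_sum_0_i:
  assumes "norm h < 1" "h \<noteq> 0"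
  shows "theta_sum 0 h \<i> = qpoch_inf (h ^ 4) ^ 2 / qpoch_inf (h ^ 8)"
proof -
  have "theta_sum 0 h \<i> = (\<Sum>\<^sub>\<infinity>n. jacobi_term (h ^ 8) (- (h ^ 4)) n)"
    unfolding theta_sum_def theta_term_conv_jacobi_term[OF assms(2) complex_i_not_zero] by simp
  then show ?thesis
    using infsum_jacobi_term_square_minus[of "h ^ 4"] norm_power_less_1[of h 4] assms
    by (simp flip: power_mult)
qed

lemma theta_sum_1_1:
  assumes "norm h < 1" "h \<noteq> 0"
  shows "theta_sum 1 h 1 = 2 * h * qpoch_inf (h ^ 16) ^ 2 / qpoch_inf (h ^ 8)"
  using infsum_jacobi_term_1[of "h ^ 8"] norm_power_less_1[of h 8] assms
  by (simp add: theta_sum_1_conv_jacobi_term flip: power_mult)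

text \<open>The number \<open>s\<close> absorbs \<open>(1 + \<i>) / w\<close>; in the application it
  is the square root of 2.\<close>

lemma theta_sum_1_sqrt_i:
  assumes "norm h < 1" "h \<noteq> 0" "w\<^sup>2 = \<i>" "1 + \<i> = s * w"
  shows "theta_sum 1 h w = s * h * qpoch_inf (h ^ 8) * qpoch_inf (h ^ 32) / qpoch_inf (h ^ 16)"
proof -
  have "w \<noteq> 0" using assms(3) by auto
  then show ?thesis
    using infsum_jacobi_term_i[of "h ^ 8"] norm_power_less_1[of h 8] assms
    by (simp add: theta_sum_1_conv_jacobi_term flip: power_mult)
qed

text \<open>In the first relation \<open>w * w ^ 3 = \<i>\<close> is a zero of the odd series, so
  one of the two products drops out. In the second, \<open>w ^ 6 = - (1 / w\<^sup>2)\<close> flips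
  the sign of the odd series but not of the even one, so the difference keeps a single product,
  doubled. The third compares the squares at 1 and \<open>\<i>\<close>, whose expansions differ only
  in the sign of the odd part.\<close>

lemma theta_sum_pair_relations:
  assumes h: "norm h < 1" "h \<noteq> 0" and w: "w ^ 4 = \<i>"
  shows "theta_sum 1 h w * theta_sum 1 h (w ^ 3) = theta_sum 1 (h\<^sup>2) (w\<^sup>2) * theta_sum 0 (h\<^sup>2) \<i>"
    and "theta_sum 1 h w ^ 2 - theta_sum 1 h (w ^ 3) ^ 2 = 2 * (theta_sum 1 (h\<^sup>2) (w\<^sup>2) * theta_sum 0 (h\<^sup>2) 1)"
    and "theta_sum 0 (h\<^sup>2) 1 ^ 2 - theta_sum 0 (h\<^sup>2) \<i> ^ 2 = 2 * theta_sum 1 (h ^ 4) 1 ^ 2"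
proof -
  have w0: "w \<noteq> 0"
    using w by auto
  have w8: "w ^ 8 = -1"
    using arg_cong[OF w, of "\<lambda>x. x\<^sup>2"] by (simp flip: power_mult)
  have w6: "w ^ 6 = - (1 / w\<^sup>2)"
    using w8 w0 by (simp add: field_simps flip: power_add)
  have T6: "theta_sum 1 g (w ^ 6) = - theta_sum 1 g (w\<^sup>2)" "theta_sum 0 g (w ^ 6) = theta_sum 0 g (w\<^sup>2)" for g
    by (simp_all add: w6 theta_sum_minus theta_sum_reflect)
  have "w / w ^ 3 = 1 / w\<^sup>2"
    using w0 by (simp add: power2_eq_square power3_eq_cube)
  then show "theta_sum 1 h w * theta_sum 1 h (w ^ 3) = theta_sum 1 (h\<^sup>2) (w\<^sup>2) * theta_sum 0 (h\<^sup>2) \<i>"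
    using theta_sum_odd_mult[OF h w0, of "w ^ 3"] w0 w
    by (simp add: theta_sum_reflect theta_sum_1_i flip: power_Suc)
  show "theta_sum 1 h w ^ 2 - theta_sum 1 h (w ^ 3) ^ 2 = 2 * (theta_sum 1 (h\<^sup>2) (w\<^sup>2) * theta_sum 0 (h\<^sup>2) 1)"
    using theta_sum_odd_mult[OF h w0 w0] theta_sum_odd_mult[OF h, of "w ^ 3" "w ^ 3"] w0
    by (simp add: T6 flip: power2_eq_square power_mult power_add)
  have h2: "norm (h\<^sup>2) < 1" "h\<^sup>2 \<noteq> 0"
    using h by (auto intro: norm_power_less_1)
  show "theta_sum 0 (h\<^sup>2) 1 ^ 2 - theta_sum 0 (h\<^sup>2) \<i> ^ 2 = 2 * theta_sum 1 (h ^ 4) 1 ^ 2"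
    using theta_sum_even_mult[OF h2, of 1 1] theta_sum_even_mult[OF h2, of \<i> \<i>]
      theta_sum_minus[of "h ^ 4" 1]
    by (simp add: power2_eq_square[of "theta_sum _ _ _"] flip: power_mult)
qed

text \<open>The even derivative series vanishes at \<open>\<i>\<close> twice: at
  \<open>w * w ^ 3\<close>, and again at \<open>(w\<^sup>2)\<^sup>2\<close> after splitting the
  remaining even series. What is left is a product of two odd derivative series at
  \<open>\<i>\<close>, each a cube; the constant is
  \<open>- 4 * (2 * \<i>) * 2 * (2 * \<i>) = 32\<close>.\<close>

lemma theta_sum_pair_wronskian:
  assumes "Im \<tau> > 0" and w: "w ^ 4 = \<i>" and h_def: "h = exp (pi * \<i> / 4 * \<tau>)"
  shows "d2theta_sum h w * theta_sum 1 h (w ^ 3) - theta_sum 1 h w * d2theta_sum h (w ^ 3)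
    = 32 * h ^ 10 * qpoch_inf (h ^ 16) ^ 3 * qpoch_inf (h ^ 64) ^ 3"
proof -
  have h: "norm h < 1" "h \<noteq> 0"
    using assms(1) by (simp_all add: h_def)
  have h2: "norm (h\<^sup>2) < 1" "norm (h ^ 8) < 1" "h\<^sup>2 \<noteq> 0" "h ^ 8 \<noteq> 0"
    using h by (auto intro: norm_power_less_1)
  have w0: "w \<noteq> 0" "w ^ 3 \<noteq> 0"
    using w by auto
  have "w / w ^ 3 = 1 / w\<^sup>2"
    using w0 by (simp add: power2_eq_square power3_eq_cube)
  then have "d2theta_sum h w * theta_sum 1 h (w ^ 3) - theta_sum 1 h w * d2theta_sum h (w ^ 3)
      = - 4 * dtheta_sum 1 (h\<^sup>2) \<i> * dtheta_sum 0 (h\<^sup>2) (w\<^sup>2)"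
    using theta_sum_wronskian[OF h w0 d2theta_sum_abs_summable[OF assms(1) w0(1), folded h_def]
        d2theta_sum_abs_summable[OF assms(1) w0(2), folded h_def]] w
    by (simp add: dtheta_sum_reflect dtheta_sum_0_i flip: power_Suc)
  also have "dtheta_sum 0 (h\<^sup>2) (w\<^sup>2) = 2 * dtheta_sum 1 (h ^ 8) \<i>"
    using dtheta_sum_0_split[OF h2(1,3), of "w\<^sup>2"] w0 w by (simp add: dtheta_sum_0_i flip: power_mult)
  finally show ?thesis
    unfolding dtheta_sum_1_i[OF h2(1,3)] dtheta_sum_1_i[OF h2(2,4)]
    by (simp add: algebra_simps flip: power_mult power_add)
qed

section \<open>The Riccati equation\<close>

lemma theta_char_conv_theta_sum:
  "theta_char 1 e 0 t = theta_sum 1 (exp (pi * \<i> / 4 * t)) (exp (pi * \<i> * e / 2))"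
  unfolding theta_char_def theta_sum_def theta_term_exp exp_power_int exp_add[symmetric]
  by (intro infsum_cong arg_cong[of _ _ exp]) (simp add: field_simps power2_eq_square)

theorem mainTheorem14:
  fixes \<tau> :: complex
  assumes "\<tau> \<in> upper_half_plane"
  defines "W \<equiv> (\<lambda>t. (theta_char 1 (1/4) 0 t)^2 / (theta_char 1 (3/4) 0 t)^2)"
  defines "q \<equiv> exp (2 * pi * \<i> * \<tau>)"
  shows "(W has_field_derivative
           (2 * pi * \<i>) *
           ((1 / (of_real (sqrt 2))^5) *
            ((qpoch_inf q)^2 * qpoch_inf (q^2) * (qpoch_inf (q^4))^3 / (qpoch_inf (q^8))^2) *
            ((W \<tau>)^2 - 6 * W \<tau> + 1))) (at \<tau>)"
proof -
  define c where "c = pi * \<i> / 4"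
  define h where "h = exp (c * \<tau>)"
  \<comment> \<open>The value of \<open>exp (pi * \<i> * e / 2)\<close> at \<open>e = 1/4\<close>;
    at \<open>e = 3/4\<close> it is \<open>w ^ 3\<close>, so both theta constants sit at powers of
    one 16th root of unity.\<close>
  define w where "w = exp (pi * \<i> / 8)"
  have \<tau>: "Im \<tau> > 0"
    using assms(1) by (simp add: upper_half_plane_def)
  have h: "norm h < 1" "h \<noteq> 0"
    using \<tau> by (simp_all add: h_def c_def)
  have w4: "w ^ 4 = \<i>"
    by (simp add: w_def exp_of_nat_mult[symmetric]) (simp add: exp_eq_polar cis_pi_half)
  have w0: "w \<noteq> 0" "w ^ 3 \<noteq> 0"
    by (simp_all add: w_def)
  have q: "q = h ^ 8"
    by (simp add: q_def h_def c_def exp_of_nat_mult[symmetric] mult_ac)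
  have theta: "theta_char 1 (1/4) 0 t = theta_sum 1 (exp (c * t)) w"
      "theta_char 1 (3/4) 0 t = theta_sum 1 (exp (c * t)) (w ^ 3)" for t
    by (simp_all add: theta_char_conv_theta_sum c_def w_def exp_of_nat_mult[symmetric] mult_ac)
  define A B where "A = theta_sum 1 h w" and "B = theta_sum 1 h (w ^ 3)"
  define A' B' where "A' = c * d2theta_sum h w" and "B' = c * d2theta_sum h (w ^ 3)"
  define s :: complex where "s = of_real (sqrt 2)"
  have s2: "s\<^sup>2 = 2"
    by (simp add: s_def flip: of_real_power)
  define E1 E2 E4 E8 where "E1 = qpoch_inf (h ^ 8)" and "E2 = qpoch_inf (h ^ 16)"
    and "E4 = qpoch_inf (h ^ 32)" and "E8 = qpoch_inf (h ^ 64)"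
  have nz: "E1 \<noteq> 0" "E2 \<noteq> 0" "E4 \<noteq> 0" "E8 \<noteq> 0" "s \<noteq> 0"
    using s2 unfolding E1_def E2_def E4_def E8_def
    by (auto intro!: qpoch_inf_nonzero norm_power_less_1 h)
  have ws: "1 + \<i> = s * w\<^sup>2"
  proof -
    have w2: "w\<^sup>2 = cis (pi / 4)"
      by (simp add: w_def exp_of_nat_mult[symmetric] cis_conv_exp mult_ac)
    show ?thesis
      unfolding w2 by (simp add: complex_eq_iff s_def cos_45 sin_45)
  qed
  have h2: "norm (h\<^sup>2) < 1" "norm (h ^ 4) < 1" "h\<^sup>2 \<noteq> 0" "h ^ 4 \<noteq> 0"
    using h by (auto intro: norm_power_less_1)
  define P V T where "P = theta_sum 1 (h\<^sup>2) (w\<^sup>2)" and "V = theta_sum 0 (h\<^sup>2) \<i>" and "T = theta_sum 1 (h ^ 4) 1"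
  have P: "P = s * h\<^sup>2 * E2 * E8 / E4"
    using theta_sum_1_sqrt_i[OF h2(1,3), of "w\<^sup>2" s] w4 ws
    by (simp add: P_def E2_def E4_def E8_def flip: power_mult)
  have V: "V = E1\<^sup>2 / E2"
    using theta_sum_0_i[OF h2(1,3)] by (simp add: V_def E1_def E2_def flip: power_mult)
  have T: "T = 2 * h ^ 4 * E8\<^sup>2 / E4"
    using theta_sum_1_1[OF h2(2,4)] by (simp add: T_def E4_def E8_def flip: power_mult)
  note rel = theta_sum_pair_relations[OF h w4, folded A_def B_def P_def V_def T_def]
  \<comment> \<open>The product formula for \<open>A * B\<close> excludes zeros of the denominator
    of \<open>W\<close> without any study of zeros of theta functions.\<close>
  have "A * B \<noteq> 0"
    unfolding rel(1) P V using nz h by simp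
  then have B0: "B \<noteq> 0" by simp
  have quartic: "A ^ 4 - 6 * A\<^sup>2 * B\<^sup>2 + B ^ 4 = 8 * P\<^sup>2 * T\<^sup>2"
  proof -
    have "A ^ 4 - 6 * A\<^sup>2 * B\<^sup>2 + B ^ 4 = (A\<^sup>2 - B\<^sup>2)\<^sup>2 - 4 * (A * B)\<^sup>2"
      by (simp add: algebra_simps power2_eq_square power4_eq_xxxx)
    also have "\<dots> = 4 * P\<^sup>2 * ((theta_sum 0 (h\<^sup>2) 1)\<^sup>2 - V\<^sup>2)"
      unfolding rel(1,2) by (simp add: algebra_simps power2_eq_square)
    finally show ?thesis
      unfolding rel(3) by simp
  qed
  \<comment> \<open>The constant 32 of the Wronskian times \<open>c = pi * \<i> / 4\<close>.\<close>
  have wronskian: "A' * B - A * B' = 8 * pi * \<i> * h ^ 10 * E2 ^ 3 * E8 ^ 3"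
    using theta_sum_pair_wronskian[OF \<tau> w4, of h]
    by (simp add: A'_def B'_def A_def B_def E2_def E8_def h_def c_def algebra_simps)
  define a b where "a = (\<lambda>t. theta_sum 1 (exp (c * t)) w)" and "b = (\<lambda>t. theta_sum 1 (exp (c * t)) (w ^ 3))"
  have da: "(a has_field_derivative A') (at \<tau>)" and db: "(b has_field_derivative B') (at \<tau>)"
    using theta_sum_has_derivative[OF \<tau> w0(1)] theta_sum_has_derivative[OF \<tau> w0(2)]
    by (simp_all add: a_def b_def A'_def B'_def h_def c_def)
  have ab: "a \<tau> = A" "b \<tau> = B"
    by (simp_all add: a_def b_def A_def B_def h_def)
  have W: "W = (\<lambda>t. (a t)\<^sup>2 / (b t)\<^sup>2)"
    by (simp add: W_def theta a_def b_def)
  have "(W has_field_derivative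
      (2 * A * A' * B\<^sup>2 - A\<^sup>2 * (2 * B * B')) / (B\<^sup>2 * B\<^sup>2)) (at \<tau>)"
    unfolding W using B0 by (auto intro!: derivative_eq_intros da db simp: ab)
  also have "(2 * A * A' * B\<^sup>2 - A\<^sup>2 * (2 * B * B')) / (B\<^sup>2 * B\<^sup>2)
      = 2 * (A * B) * (A' * B - A * B') / B ^ 4"
    using B0 by (simp add: field_simps power2_eq_square power4_eq_xxxx)
  \<comment> \<open>Both sides equal
    \<open>16 * pi * \<i> * s * h ^ 12 * E1 ^ 2 * E2 ^ 3 * E8 ^ 4 / E4\<close>; the numerical
    constants agree because \<open>s ^ 4 = 4\<close>.\<close>
  also have "2 * (A * B) * (A' * B - A * B')
      = 2 * pi * \<i> * (1 / s ^ 5 * (E1\<^sup>2 * E2 * E4 ^ 3 / E8\<^sup>2) * (8 * P\<^sup>2 * T\<^sup>2))"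
  proof -
    have ss: "s * (s * x) = 2 * x" for x
      using s2 by (simp add: power2_eq_square flip: mult.assoc)
    have "s ^ 5 = 4 * s" "h ^ 10 = h * (h * h ^ 8)"
      by (simp_all add: numeral_eq_Suc ss)
    then show ?thesis
      unfolding rel(1) wronskian P V T using nz
      by (simp add: field_simps power2_eq_square power3_eq_cube ss)
  qed
  also have "2 * pi * \<i> * (1 / s ^ 5 * (E1\<^sup>2 * E2 * E4 ^ 3 / E8\<^sup>2) * (8 * P\<^sup>2 * T\<^sup>2)) / B ^ 4
      = 2 * pi * \<i> * (1 / s ^ 5 * (E1\<^sup>2 * E2 * E4 ^ 3 / E8\<^sup>2) * ((A ^ 4 - 6 * A\<^sup>2 * B\<^sup>2 + B ^ 4) / B ^ 4))"
    unfolding quartic by simp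
  also have "(A ^ 4 - 6 * A\<^sup>2 * B\<^sup>2 + B ^ 4) / B ^ 4 = (W \<tau>)\<^sup>2 - 6 * W \<tau> + 1"
    using B0 by (simp add: W ab field_simps power2_eq_square power4_eq_xxxx)
  finally show ?thesis
    unfolding q s_def E1_def E2_def E4_def E8_def by (simp flip: power_mult)
qed

end
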